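(* For all $N\in\mathbb N$, $\alpha\in(0,N)$ and $p\ge1$, the normed space $E^{\alpha,p}(\mathbb R^N)$ is complete.
   Context: $\mathbb N$ denotes the positive integers. For $\alpha\in(0,N)$ the Riesz potential is $I_\alpha(x)=A_\alpha|x|^{-(N-\alpha)}$ for $x\in\mathbb R^N\setminus\{0\}$, with $A_\alpha=\frac{\Gamma((N-\alpha)/2)}{\Gamma(\alpha/2)\pi^{N/2}2^\alpha}$. For $p\ge1$, the Coulomb--Sobolev space $E^{\alpha,p}(\mathbb R^N)$ is the vector space of (a.e. classes of) measurable functions $u:\mathbb R^N\to\mathbb R$ with $\int_{\mathbb R^N}|I_{\alpha/2}*|u|^p|^2<\infty$ that are weakly differentiable with $Du\in L^2(\mathbb R^N)$, normed by $$\|u\|_{E^{\alpha,p}}=\Bigl(\int_{\mathbb R^N}|Du|^2+\Bigl(\int_{\mathbb R^N}\bigl|I_{\alpha/2}*|u|^p\bigr|^2\Bigr)^{1/p}\Bigr)^{1/2}.$$ *)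

theory Defs
  imports "HOL-Analysis.Analysis"
begin

definition ae_rel :: "(real^'n \<Rightarrow> real) \<Rightarrow> (real^'n \<Rightarrow> real) \<Rightarrow> bool" where
  "ae_rel f g \<longleftrightarrow> f \<in> borel_measurable lebesgue \<and> g \<in> borel_measurable lebesgue \<and>
    (AE x in lebesgue. f x = g x)"

lemma part_equivp_ae_rel: "part_equivp ae_rel"
proof (rule part_equivpI)
  show "\<exists>f. ae_rel f (f :: real^'n \<Rightarrow> real)"
    by (intro exI[of _ "\<lambda>_. 0"]) (simp add: ae_rel_def)
  show "symp ae_rel"
    by (auto simp: symp_def ae_rel_def elim: eventually_mono)
  show "transp ae_rel"
    unfolding transp_def ae_rel_def by (auto elim: AE_mp)
qed

quotient_type 'n ae_fun = "real^'n::finite \<Rightarrow> real" / partial: ae_rel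
  by (rule part_equivp_ae_rel)

instantiation ae_fun :: (finite) real_vector
begin

lift_definition zero_ae_fun :: "'a ae_fun" is "\<lambda>_. 0"
  by (simp add: ae_rel_def)

lift_definition plus_ae_fun :: "'a ae_fun \<Rightarrow> 'a ae_fun \<Rightarrow> 'a ae_fun"
  is "\<lambda>f g x. f x + g x"
  unfolding ae_rel_def by (auto elim: AE_mp)

lift_definition minus_ae_fun :: "'a ae_fun \<Rightarrow> 'a ae_fun \<Rightarrow> 'a ae_fun"
  is "\<lambda>f g x. f x - g x"
  unfolding ae_rel_def by (auto elim: AE_mp)

lift_definition uminus_ae_fun :: "'a ae_fun \<Rightarrow> 'a ae_fun"
  is "\<lambda>f x. - f x"
  unfolding ae_rel_def by (auto elim: AE_mp)

lift_definition scaleR_ae_fun :: "real \<Rightarrow> 'a ae_fun \<Rightarrow> 'a ae_fun"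
  is "\<lambda>c f x. c * f x"
  unfolding ae_rel_def by (auto elim: AE_mp)

instance
  by standard (transfer; auto simp: ae_rel_def algebra_simps)+

end

primrec C_k :: "nat \<Rightarrow> (real^'n \<Rightarrow> real) \<Rightarrow> bool" where
  "C_k 0 f \<longleftrightarrow> continuous_on UNIV f"
| "C_k (Suc k) f \<longleftrightarrow> (\<forall>x. f differentiable at x) \<and>
    (\<forall>i. C_k k (\<lambda>x. frechet_derivative f (at x) (axis i 1)))"

definition test_functions :: "(real^'n \<Rightarrow> real) set" where
  "test_functions = {\<phi>. (\<forall>k. C_k k \<phi>) \<and> compact (closure {x. \<phi> x \<noteq> 0})}"

definition locally_integrable :: "(real^'n \<Rightarrow> 'b::{banach, second_countable_topology}) \<Rightarrow> bool" where
  "locally_integrable f \<longleftrightarrow> (\<forall>K. compact K \<longrightarrow> set_integrable lebesgue K f)"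

definition has_weak_gradient :: "(real^'n \<Rightarrow> real) \<Rightarrow> (real^'n \<Rightarrow> real^'n) \<Rightarrow> bool" where
  "has_weak_gradient f g \<longleftrightarrow> locally_integrable f \<and> locally_integrable g \<and>
    (\<forall>\<phi>\<in>test_functions. \<forall>i.
      (LINT x|lebesgue. f x * frechet_derivative \<phi> (at x) (axis i 1)) =
      - (LINT x|lebesgue. g x $ i * \<phi> x))"

definition weakly_differentiable :: "(real^'n \<Rightarrow> real) \<Rightarrow> bool" where
  "weakly_differentiable f \<longleftrightarrow> (\<exists>g. has_weak_gradient f g)"

text \<open>The weak gradient is unique only up to null sets, so this is one representative of it.
  It is unspecified if \<^term>\<open>f\<close> is not weakly differentiable.\<close>

definition weak_gradient :: "(real^'n \<Rightarrow> real) \<Rightarrow> real^'n \<Rightarrow> real^'n" where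
  "weak_gradient f = (SOME g. has_weak_gradient f g)"

definition dirichlet_energy :: "(real^'n \<Rightarrow> real) \<Rightarrow> ennreal" where
  "dirichlet_energy f = (\<integral>\<^sup>+x. ennreal ((norm (weak_gradient f x))\<^sup>2) \<partial>lebesgue)"

text \<open>The Riesz potential is undefined at the origin; here it gets the value
  \<open>0\<close> there, which does not affect convolutions.\<close>

definition riesz_potential :: "real \<Rightarrow> real^'n \<Rightarrow> real" where
  "riesz_potential \<alpha> x =
    Gamma ((real CARD('n) - \<alpha>) / 2) /
      (Gamma (\<alpha> / 2) * pi powr (real CARD('n) / 2) * 2 powr \<alpha>) *
    norm x powr - (real CARD('n) - \<alpha>)"

text \<open>Both factors of \<open>I\<^sub>\<beta> * |f|\<^sup>p\<close> are nonnegative, so the convolution is defined everywhere, possibly as \<open>\<infinity>\<close>.\<close>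

definition riesz_convolution :: "real \<Rightarrow> real \<Rightarrow> (real^'n \<Rightarrow> real) \<Rightarrow> real^'n \<Rightarrow> ennreal" where
  "riesz_convolution \<beta> p f x =
    (\<integral>\<^sup>+y. ennreal (riesz_potential \<beta> (x - y) * \<bar>f y\<bar> powr p) \<partial>lebesgue)"

definition coulomb_energy :: "real \<Rightarrow> real \<Rightarrow> (real^'n \<Rightarrow> real) \<Rightarrow> ennreal" where
  "coulomb_energy \<alpha> p f = (\<integral>\<^sup>+x. (riesz_convolution (\<alpha> / 2) p f x)\<^sup>2 \<partial>lebesgue)"

lemma has_weak_gradient_cong_AE:
  fixes f f' :: "real^'n \<Rightarrow> real"
  assumes "ae_rel f f'"
  shows "has_weak_gradient f g \<longleftrightarrow> has_weak_gradient f' g"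
proof -
  have imp: "has_weak_gradient v g"
    if uv: "ae_rel u v" and u: "has_weak_gradient u g" for u v :: "real^'n \<Rightarrow> real"
  proof -
    have m: "u \<in> borel_measurable lebesgue" "v \<in> borel_measurable lebesgue"
      and ae: "AE x in lebesgue. u x = v x"
      using uv by (auto simp: ae_rel_def)
    have "set_integrable lebesgue K v" if "compact K" for K
    proof -
      have K: "K \<in> sets lebesgue"
        using that by (simp add: borel_compact)
      have "set_integrable lebesgue K u"
        using u that by (simp add: has_weak_gradient_def locally_integrable_def)
      moreover have "AE x in lebesgue. indicator K x *\<^sub>R u x = indicator K x *\<^sub>R v x"
        using ae by (auto elim: eventually_mono)
      moreover have "(\<lambda>x. indicator K x *\<^sub>R v x) \<in> borel_measurable lebesgue"
        using m K by (intro borel_measurable_scaleR borel_measurable_indicator)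
      ultimately show ?thesis
        unfolding set_integrable_def by (blast intro: integrable_cong_AE_imp)
    qed
    moreover have "(LINT x|lebesgue. v x * h x) = (LINT x|lebesgue. u x * h x)"
      if "h \<in> borel_measurable lebesgue" for h :: "real^'n \<Rightarrow> real"
      using ae m that by (intro integral_cong_AE) (auto elim: eventually_mono)
    moreover have "(\<lambda>x. frechet_derivative \<phi> (at x) (axis i 1)) \<in> borel_measurable lebesgue"
      if "\<phi> \<in> test_functions" for \<phi> :: "real^'n \<Rightarrow> real" and i
    proof -
      have "C_k (Suc 0) \<phi>"
        using that unfolding test_functions_def by blast
      hence "continuous_on UNIV (\<lambda>x. frechet_derivative \<phi> (at x) (axis i 1))"
        by simp
      thus ?thesis
        by (simp add: borel_measurable_continuous_onI measurable_completion)
    qed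
    ultimately show ?thesis
      using u by (simp add: has_weak_gradient_def locally_integrable_def)
  qed
  have "ae_rel f' f"
    using assms by (auto simp: ae_rel_def elim: eventually_mono)
  thus ?thesis
    using imp assms by blast
qed

lemma weak_gradient_cong_AE: "ae_rel f f' \<Longrightarrow> weak_gradient f = weak_gradient f'"
  by (simp add: weak_gradient_def has_weak_gradient_cong_AE)

lemma dirichlet_energy_cong_AE: "ae_rel f f' \<Longrightarrow> dirichlet_energy f = dirichlet_energy f'"
  by (simp add: dirichlet_energy_def weak_gradient_cong_AE)

lemma coulomb_energy_cong_AE:
  assumes "ae_rel f f'"
  shows "coulomb_energy \<alpha> p f = coulomb_energy \<alpha> p f'"
proof -
  have "riesz_convolution \<beta> p f x = riesz_convolution \<beta> p f' x" for \<beta> x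
    unfolding riesz_convolution_def using assms
    by (intro nn_integral_cong_AE) (auto simp: ae_rel_def elim: eventually_mono)
  thus ?thesis
    by (simp add: coulomb_energy_def)
qed

lift_definition coulomb_sobolev :: "real \<Rightarrow> real \<Rightarrow> 'n::finite ae_fun \<Rightarrow> bool"
  is "\<lambda>\<alpha> p f. coulomb_energy \<alpha> p f < \<infinity> \<and> weakly_differentiable f \<and> dirichlet_energy f < \<infinity>"
  by (simp add: weakly_differentiable_def coulomb_energy_cong_AE dirichlet_energy_cong_AE
      has_weak_gradient_cong_AE)

definition coulomb_sobolev_space :: "real \<Rightarrow> real \<Rightarrow> 'n::finite ae_fun set" where
  "coulomb_sobolev_space \<alpha> p = {u. coulomb_sobolev \<alpha> p u}"

lift_definition coulomb_sobolev_norm :: "real \<Rightarrow> real \<Rightarrow> 'n::finite ae_fun \<Rightarrow> real"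
  is "\<lambda>\<alpha> p f. sqrt (enn2real (dirichlet_energy f) +
    enn2real (coulomb_energy \<alpha> p f) powr (1 / p))"
  by (simp add: coulomb_energy_cong_AE dirichlet_energy_cong_AE)

text \<open>A linear subspace \<^term>\<open>S\<close> of a real vector space, normed by \<^term>\<open>\<nu>\<close>; the values of
  \<^term>\<open>\<nu>\<close> outside \<^term>\<open>S\<close> play no role.\<close>

definition normed_space_on :: "'v::real_vector set \<Rightarrow> ('v \<Rightarrow> real) \<Rightarrow> bool" where
  "normed_space_on S \<nu> \<longleftrightarrow> subspace S \<and>
    (\<forall>u\<in>S. 0 \<le> \<nu> u \<and> (\<nu> u = 0 \<longleftrightarrow> u = 0)) \<and>
    (\<forall>c. \<forall>u\<in>S. \<nu> (c *\<^sub>R u) = \<bar>c\<bar> * \<nu> u) \<and>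
    (\<forall>u\<in>S. \<forall>v\<in>S. \<nu> (u + v) \<le> \<nu> u + \<nu> v)"

definition complete_normed_space_on :: "'v::real_vector set \<Rightarrow> ('v \<Rightarrow> real) \<Rightarrow> bool" where
  "complete_normed_space_on S \<nu> \<longleftrightarrow> normed_space_on S \<nu> \<and>
    Metric_space.mcomplete S (\<lambda>u v. \<nu> (u - v))"

end

theory Submission
  imports Defs
begin

text \<open>The two summands of the norm can be treated separately. Write $D(u)$ for the Dirichlet energy and $E(u)$ for the
Coulomb energy $\int |I_{\alpha/2} * |u|^p|^2$.

\<^emph>\<open>It is a norm.\<close> Both energies are convex, because they are built from $|\cdot|^p$ and from squares by
integration against nonnegative weights, and they are homogeneous, of degrees $2$ and $2p$. For a
convex functional that is homogeneous of degree $q$ the $q$-th root is subadditive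
(\<open>convex_homogeneous_root_subadditive\<close>); this replaces two applications of Minkowski's inequality.
So $D^{1/2}$ and $E^{1/(2p)}$ are seminorms, and the norm is the Euclidean combination of the two.
It vanishes only at $0$ because $E$ controls the $L^1$ norm on every ball
(\<open>coulomb_energy_controls_ball_L1\<close>): the Riesz kernel is bounded below on a bounded set.

\<^emph>\<open>The gradient is well defined.\<close> The energy $D$ uses a chosen representative of the weak gradient,
so all of this needs its uniqueness up to null sets, which follows from the fundamental lemma of the
calculus of variations. That lemma is proved with explicit smooth bumps that converge pointwise to the indicator of a
box; the positive and the negative part of a function that is orthogonal to all test functions then
have the same integral over every box, hence define the same measure.

\<^emph>\<open>It is complete.\<close> Take a Cauchy sequence whose tails are geometrically small; every Cauchy sequence has such
a subsequence. By the local control, $u_k$ and $Du_k$ are summably Cauchy in $L^1$ of every ball, hence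
converge almost everywhere and locally in $L^1$ to some $u$ and $g$
(\<open>fast_local_Cauchy_limit\<close>). Local $L^1$ convergence is enough to pass to the limit in the definition
of the weak gradient, so $g = Du$. Fatou's lemma, applied to $u_j - u_k$ for $j \to \infty$, bounds
$D(u - u_k)$ and $E(u - u_k)$ by the Cauchy bounds, so $u$ lies in the space and is the limit.\<close>

section \<open>Smooth bump functions\<close>

text \<open>The derivatives of $t \mapsto e^{-1/t}$, extended by $0$ to $t \le 0$, have the form
$P(1/t) e^{-1/t}$ with a polynomial $P$. Keeping $P$ as a parameter makes the class closed under
differentiation.\<close>

definition flat_exp :: "real poly \<Rightarrow> real \<Rightarrow> real" where
  "flat_exp P t = (if t \<le> 0 then 0 else poly P (1 / t) * exp (- (1 / t)))"

lemma poly_times_exp_neg_tendsto_0: "((\<lambda>s::real. poly P s * exp (- s)) \<longlongrightarrow> 0) at_top"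
proof -
  have "((\<lambda>s. \<Sum>i\<le>degree P. coeff P i * (s ^ i / exp s)) \<longlongrightarrow> (\<Sum>i\<le>degree P. coeff P i * 0)) at_top"
    by (intro tendsto_intros tendsto_power_div_exp_0)
  moreover have "(\<Sum>i\<le>degree P. coeff P i * (s ^ i / exp s)) = poly P s * exp (- s)" for s
    by (simp add: poly_altdef sum_distrib_right exp_minus divide_inverse mult.assoc)
  ultimately show ?thesis by simp
qed

text \<open>With $s = 1/t$ this is the decay of $P(s) e^{-s}$ at infinity.\<close>

lemma flat_exp_tendsto_0: "(flat_exp P \<longlongrightarrow> 0) (at 0)"
proof -
  have "((\<lambda>t::real. poly P (1 / t) * exp (- (1 / t))) \<longlongrightarrow> 0) (at_right 0)"
    using filterlim_compose[OF poly_times_exp_neg_tendsto_0 filterlim_inverse_at_top_right]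
    by (simp add: inverse_eq_divide)
  moreover have "eventually (\<lambda>t. poly P (1 / t) * exp (- (1 / t)) = flat_exp P t) (at_right 0)"
    by (auto simp: eventually_at_filter flat_exp_def)
  ultimately have "(flat_exp P \<longlongrightarrow> 0) (at_right 0)"
    by (rule Lim_transform_eventually)
  moreover have "(flat_exp P \<longlongrightarrow> 0) (at_left 0)"
    by (rule Lim_transform_eventually[OF tendsto_const])
      (auto simp: eventually_at_filter flat_exp_def)
  ultimately show ?thesis
    using filterlim_split_at by blast
qed

text \<open>Away from $0$ this is the product rule. At $0$ the difference quotient of the function for $P(s)$ is the
function for $s P(s)$, so it tends to $0$.\<close>

lemma flat_exp_has_derivative:
  "(flat_exp P has_real_derivative flat_exp ([:0, 0, 1:] * (P - pderiv P)) t) (at t)"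
proof -
  consider "t > 0" | "t < 0" | "t = 0" by linarith
  then show ?thesis
  proof cases
    case 1
    have "((\<lambda>t. poly P (1 / t) * exp (- (1 / t))) has_real_derivative
        flat_exp ([:0, 0, 1:] * (P - pderiv P)) t) (at t)"
      using 1 unfolding flat_exp_def
      by (auto intro!: derivative_eq_intros DERIV_chain'[OF _ poly_DERIV] simp: field_simps power2_eq_square)
    then show ?thesis
      by (rule has_field_derivative_transform_within_open[where S="{0<..}"])
        (use 1 in \<open>auto simp: flat_exp_def\<close>)
  next
    case 2
    have "((\<lambda>t. 0) has_real_derivative flat_exp ([:0, 0, 1:] * (P - pderiv P)) t) (at t)"
      using 2 by (simp add: flat_exp_def)
    then show ?thesis
      by (rule has_field_derivative_transform_within_open[where S="{..<0}"])
        (use 2 in \<open>auto simp: flat_exp_def\<close>)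
  next
    case 3
    have eq: "flat_exp (pCons 0 P) = (\<lambda>h. (flat_exp P (0 + h) - flat_exp P 0) / h)"
      by (rule ext) (simp add: flat_exp_def)
    have 0: "flat_exp ([:0, 0, 1:] * (P - pderiv P)) 0 = 0"
      by (simp add: flat_exp_def)
    show ?thesis
      unfolding 3 DERIV_def 0 eq[symmetric] by (rule flat_exp_tendsto_0)
  qed
qed

text \<open>A set of differentiable functions that is closed under partial derivatives consists of smooth
functions. This one is just large enough to contain the bumps below.\<close>

inductive_set smooth_terms :: "(real^'n \<Rightarrow> real) set" where
  const: "(\<lambda>x. c) \<in> smooth_terms"
| flat: "(\<lambda>x. flat_exp P (c * x $ i + d)) \<in> smooth_terms"
| add: "f \<in> smooth_terms \<Longrightarrow> g \<in> smooth_terms \<Longrightarrow> (\<lambda>x. f x + g x) \<in> smooth_terms"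
| mult: "f \<in> smooth_terms \<Longrightarrow> g \<in> smooth_terms \<Longrightarrow> (\<lambda>x. f x * g x) \<in> smooth_terms"

lemma smooth_terms_prod:
  "finite I \<Longrightarrow> (\<And>i. i \<in> I \<Longrightarrow> f i \<in> smooth_terms) \<Longrightarrow> (\<lambda>x. \<Prod>i\<in>I. f i x) \<in> smooth_terms"
  by (induction I rule: finite_induct) (auto intro: smooth_terms.intros)

lemma smooth_terms_derivative:
  fixes f :: "real^'n \<Rightarrow> real"
  assumes "f \<in> smooth_terms"
  shows "(\<forall>x. f differentiable at x) \<and>
    (\<forall>i. (\<lambda>x. frechet_derivative f (at x) (axis i 1)) \<in> smooth_terms)"
  using assms
proof induction
  case (const c)
  then show ?case by (auto intro: smooth_terms.const)
next
  case (flat P c j d)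
  define P' where "P' = [:0, 0, 1:] * (P - pderiv P)"
  have *: "((\<lambda>x::real^'n. flat_exp P (c * x $ j + d)) has_derivative
      (\<lambda>h. flat_exp P' (c * x $ j + d) * (c * h $ j))) (at x)" for x
  proof -
    have "((\<lambda>x::real^'n. c * x $ j + d) has_derivative (\<lambda>h. c * h $ j)) (at x)"
      by (auto intro!: derivative_eq_intros bounded_linear_imp_has_derivative bounded_linear_vec_nth)
    from has_derivative_compose[OF this has_field_derivative_imp_has_derivative[OF flat_exp_has_derivative]]
    show ?thesis by (simp add: P'_def)
  qed
  have "frechet_derivative (\<lambda>x::real^'n. flat_exp P (c * x $ j + d)) (at x) =
      (\<lambda>h. flat_exp P' (c * x $ j + d) * (c * h $ j))" for x
    using frechet_derivative_at[OF *] by simp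
  moreover have "(\<lambda>x::real^'n. flat_exp P' (c * x $ j + d) * (c * (axis i 1 :: real^'n) $ j)) \<in> smooth_terms" for i
    by (intro smooth_terms.intros)
  ultimately show ?case
    using * by (auto simp: differentiable_def)
next
  case (add f g)
  then have "frechet_derivative (\<lambda>x. f x + g x) (at x) =
      (\<lambda>h. frechet_derivative f (at x) h + frechet_derivative g (at x) h)" for x
    by (intro frechet_derivative_at[symmetric] has_derivative_add)
      (auto simp: frechet_derivative_works[symmetric])
  then show ?case
    using add by (auto intro: smooth_terms.add)
next
  case (mult f g)
  then have "frechet_derivative (\<lambda>x. f x * g x) (at x) =
      (\<lambda>h. f x * frechet_derivative g (at x) h + frechet_derivative f (at x) h * g x)" for x
    by (intro frechet_derivative_at[symmetric] has_derivative_mult)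
      (auto simp: frechet_derivative_works[symmetric])
  then show ?case
    using mult by (simp add: smooth_terms.add smooth_terms.mult)
qed

lemma smooth_terms_C_k: "f \<in> smooth_terms \<Longrightarrow> C_k k f"
proof (induction k arbitrary: f)
  case 0
  then show ?case
    using smooth_terms_derivative[OF 0]
    by (auto simp: continuous_on_eq_continuous_at differentiable_imp_continuous_within)
next
  case (Suc k)
  then show ?case
    using smooth_terms_derivative[OF Suc.prems] by auto
qed

text \<open>A smooth function that is positive exactly on the box; for $m \to \infty$ each
factor tends to $1$ where it is positive, so the bump tends to the indicator of the box.\<close>

definition box_bump :: "real^'n \<Rightarrow> real^'n \<Rightarrow> real \<Rightarrow> real^'n \<Rightarrow> real" where
  "box_bump a b m x = (\<Prod>i\<in>UNIV. flat_exp 1 (m * (x $ i - a $ i)) * flat_exp 1 (m * (b $ i - x $ i)))"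

lemma flat_exp_1: "flat_exp 1 t = (if t \<le> 0 then 0 else exp (- (1 / t)))"
  by (simp add: flat_exp_def)

lemma flat_exp_1_bounds: "0 \<le> flat_exp 1 t" "flat_exp 1 t \<le> 1"
  by (auto simp: flat_exp_1)

lemma box_bump_bounds: "0 \<le> box_bump a b m x" "box_bump a b m x \<le> 1"
  unfolding box_bump_def
  by (auto intro!: prod_nonneg prod_le_1 mult_nonneg_nonneg mult_le_one flat_exp_1_bounds)

lemma box_bump_eq_0:
  assumes "m > 0" "x \<notin> box a b"
  shows "box_bump a b m x = 0"
proof -
  obtain i where "\<not> (a $ i < x $ i \<and> x $ i < b $ i)"
    using assms by (auto simp: mem_box_cart)
  then show ?thesis
    unfolding box_bump_def using assms
    by (intro prod_zero bexI[of _ i]) (auto simp: flat_exp_1 mult_le_0_iff not_less)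
qed

lemma box_bump_test_function:
  assumes "m > 0"
  shows "box_bump a b m \<in> test_functions"
proof -
  have "(\<lambda>x. \<Prod>i\<in>UNIV. flat_exp 1 (m * x $ i + (- m * a $ i)) * flat_exp 1 (- m * x $ i + m * b $ i)) \<in> smooth_terms"
    by (intro smooth_terms_prod smooth_terms.intros) auto
  also have "(\<lambda>x. \<Prod>i\<in>UNIV. flat_exp 1 (m * x $ i + (- m * a $ i)) * flat_exp 1 (- m * x $ i + m * b $ i)) = box_bump a b m"
    by (auto simp: box_bump_def algebra_simps intro!: prod.cong ext)
  finally have "C_k k (box_bump a b m)" for k
    by (rule smooth_terms_C_k)
  moreover have "bounded {x. box_bump a b m x \<noteq> 0}"
    using box_bump_eq_0[OF assms] by (intro bounded_subset[OF bounded_box[of a b]]) auto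
  ultimately show ?thesis
    by (simp add: test_functions_def compact_closure)
qed

lemma box_bump_tendsto: "(\<lambda>m. box_bump a b (real (Suc m)) x) \<longlonglongrightarrow> indicator (box a b) x"
proof (cases "x \<in> box a b")
  case True
  have "(\<lambda>m. flat_exp 1 (real (Suc m) * t)) \<longlonglongrightarrow> 1" if "t > 0" for t
  proof -
    have "(\<lambda>m. exp (- (inverse (real (Suc m)) * (1 / t)))) \<longlonglongrightarrow> exp (- (0 * (1 / t)))"
      by (intro tendsto_intros LIMSEQ_inverse_real_of_nat)
    moreover have "flat_exp 1 (real (Suc m) * t) = exp (- (inverse (real (Suc m)) * (1 / t)))" for m
      using that by (simp add: flat_exp_1 mult_le_0_iff inverse_eq_divide)
    ultimately show ?thesis by simp
  qed
  then have "(\<lambda>m. box_bump a b (real (Suc m)) x) \<longlonglongrightarrow> (\<Prod>i\<in>(UNIV::'a set). 1 * 1)"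
    unfolding box_bump_def using True
    by (intro tendsto_prod tendsto_mult) (auto simp: mem_box_cart)
  then show ?thesis using True by simp
next
  case False
  then show ?thesis using box_bump_eq_0[of _ x a b] by simp
qed

section \<open>Uniqueness of the weak gradient\<close>

text \<open>The function is the pointwise limit of its truncations to balls, which are integrable.\<close>

lemma locally_integrable_measurable:
  assumes "locally_integrable f"
  shows "f \<in> borel_measurable lebesgue"
proof (rule borel_measurable_LIMSEQ_metric)
  show "(\<lambda>x. indicator (cball 0 (real n)) x *\<^sub>R f x) \<in> borel_measurable lebesgue" for n
    using assms unfolding locally_integrable_def set_integrable_def
    by (intro borel_measurable_integrable) auto
next
  fix x :: "real^'a"
  obtain m where m: "norm x \<le> real m" using real_arch_simple by blast
  have "eventually (\<lambda>n. indicator (cball 0 (real n)) x *\<^sub>R f x = f x) sequentially"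
    using eventually_ge_at_top[of m] by eventually_elim (use m in auto)
  then show "(\<lambda>n. indicator (cball 0 (real n)) x *\<^sub>R f x) \<longlonglongrightarrow> f x"
    by (rule tendsto_eventually)
qed

lemma locally_integrable_componentwise:
  fixes g :: "real^'n \<Rightarrow> real^'m"
  assumes "locally_integrable g"
  shows "locally_integrable (\<lambda>x. g x $ i)"
  unfolding locally_integrable_def set_integrable_def
proof (intro allI impI)
  fix K :: "(real^'n) set" assume "compact K"
  then have "integrable lebesgue (\<lambda>x. (indicator K x *\<^sub>R g x) $ i)"
    using assms unfolding locally_integrable_def set_integrable_def
    by (intro integrable_bounded_linear[OF bounded_linear_vec_nth]) auto
  then show "integrable lebesgue (\<lambda>x. indicator K x *\<^sub>R g x $ i)" by simp
qed

lemma locally_integrable_diff: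
  "locally_integrable f \<Longrightarrow> locally_integrable g \<Longrightarrow> locally_integrable (\<lambda>x. f x - g x)"
  unfolding locally_integrable_def by auto

lemma locally_integrable_add:
  "locally_integrable f \<Longrightarrow> locally_integrable g \<Longrightarrow> locally_integrable (\<lambda>x. f x + g x)"
  unfolding locally_integrable_def by auto

lemma locally_integrable_scaleR:
  "locally_integrable f \<Longrightarrow> locally_integrable (\<lambda>x. c *\<^sub>R f x)"
  unfolding locally_integrable_def by auto

lemma integrable_locally_integrable_mult:
  fixes f h :: "real^'n \<Rightarrow> real"
  assumes f: "locally_integrable f" and h: "h \<in> borel_measurable lebesgue"
    and K: "compact K" "\<And>x. x \<notin> K \<Longrightarrow> h x = 0" and M: "\<And>x. \<bar>h x\<bar> \<le> M"
  shows "integrable lebesgue (\<lambda>x. f x * h x)"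
proof -
  have "integrable lebesgue (\<lambda>x. M *\<^sub>R (indicator K x *\<^sub>R f x))"
    using f K unfolding locally_integrable_def set_integrable_def by auto
  then show ?thesis
  proof (rule Bochner_Integration.integrable_bound)
    show "(\<lambda>x. f x * h x) \<in> borel_measurable lebesgue"
      using locally_integrable_measurable[OF f] h by measurable
    have "norm (f x * h x) \<le> norm (M *\<^sub>R (indicator K x *\<^sub>R f x))" for x
    proof (cases "x \<in> K")
      case True
      have "\<bar>h x\<bar> \<le> \<bar>M\<bar>" using M[of x] by linarith
      then show ?thesis
        using True mult_left_mono[of "\<bar>h x\<bar>" "\<bar>M\<bar>" "\<bar>f x\<bar>"]
        by (auto simp: abs_mult mult.commute)
    qed (use K in auto)
    then show "AE x in lebesgue. norm (f x * h x) \<le> norm (M *\<^sub>R (indicator K x *\<^sub>R f x))"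
      by simp
  qed
qed

text \<open>A test function and its first derivatives are continuous and vanish off the support, so they are
bounded; this makes their products with locally integrable functions integrable.\<close>

lemma test_function_bounds:
  fixes \<phi> :: "real^'n \<Rightarrow> real"
  assumes "\<phi> \<in> test_functions"
  obtains K M where "compact K" "\<And>x. x \<notin> K \<Longrightarrow> \<phi> x = 0"
    "\<And>x i. x \<notin> K \<Longrightarrow> frechet_derivative \<phi> (at x) (axis i 1) = 0"
    "\<And>x. \<bar>\<phi> x\<bar> \<le> M" "\<And>x i. \<bar>frechet_derivative \<phi> (at x) (axis i 1)\<bar> \<le> M"
    "\<phi> \<in> borel_measurable lebesgue"
    "\<And>i. (\<lambda>x. frechet_derivative \<phi> (at x) (axis i 1)) \<in> borel_measurable lebesgue"
proof -
  define K where "K = closure {x. \<phi> x \<noteq> 0}"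
  let ?d = "\<lambda>i x. frechet_derivative \<phi> (at x) (axis i 1)"
  have K: "compact K" and C: "\<And>k. C_k k \<phi>"
    using assms by (auto simp: test_functions_def K_def)
  have cont: "continuous_on UNIV \<phi>" "\<And>i. continuous_on UNIV (?d i)"
    using C[of 0] C[of "Suc 0"] by auto
  have z: "\<phi> x = 0" if "x \<notin> K" for x
    using that closure_subset[of "{x. \<phi> x \<noteq> 0}"] unfolding K_def by blast
  have dz: "?d i x = 0" if "x \<notin> K" for x i
  proof -
    have "(\<phi> has_derivative (\<lambda>h. 0)) (at x)"
      by (rule has_derivative_transform_within_open[of "\<lambda>_. 0", where s="- K"])
        (use that z K in \<open>auto simp: compact_imp_closed\<close>)
    then show ?thesis using frechet_derivative_at by metis
  qed
  have bdd: "\<exists>M. \<forall>x. \<bar>h x\<bar> \<le> M" if "continuous_on UNIV h" "\<And>x. x \<notin> K \<Longrightarrow> h x = 0" for h :: "real^'n \<Rightarrow> real"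
  proof -
    have "bounded (h ` K)"
      using that K by (intro compact_imp_bounded compact_continuous_image)
        (auto intro: continuous_on_subset)
    then obtain M where "\<And>x. x \<in> K \<Longrightarrow> \<bar>h x\<bar> \<le> M" by (auto simp: bounded_iff)
    then have "\<bar>h x\<bar> \<le> max M 0" for x
      using that(2)[of x] by (cases "x \<in> K") (auto simp: le_max_iff_disj)
    then show ?thesis by blast
  qed
  obtain M0 where M0: "\<And>x. \<bar>\<phi> x\<bar> \<le> M0" using bdd[OF cont(1) z] by blast
  have "\<forall>i. \<exists>M. \<forall>x. \<bar>?d i x\<bar> \<le> M" using bdd[OF cont(2) dz] by blast
  then obtain M1 where M1: "\<And>i x. \<bar>?d i x\<bar> \<le> M1 i" by metis
  define M where "M = Max (insert M0 (range M1))"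
  have "M0 \<le> M" "M1 i \<le> M" for i
    unfolding M_def by (intro Max_ge; simp)+
  then have bnd: "\<bar>\<phi> x\<bar> \<le> M" "\<bar>?d i x\<bar> \<le> M" for x i
    using order_trans[OF M0] order_trans[OF M1] by auto
  have meas: "\<phi> \<in> borel_measurable lebesgue" "?d i \<in> borel_measurable lebesgue" for i
    using cont by (auto intro!: borel_measurable_continuous_onI measurable_completion)
  show ?thesis
    by (rule that[OF K z dz bnd meas])
qed

lemma integrable_times_test_function:
  assumes f: "locally_integrable f" and \<phi>: "\<phi> \<in> test_functions"
  shows "integrable lebesgue (\<lambda>x. f x * \<phi> x)"
    and "integrable lebesgue (\<lambda>x. f x * frechet_derivative \<phi> (at x) (axis i 1))"
proof -
  obtain K M where *: "compact K" "\<And>x. x \<notin> K \<Longrightarrow> \<phi> x = 0"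
    "\<And>x i. x \<notin> K \<Longrightarrow> frechet_derivative \<phi> (at x) (axis i 1) = 0"
    "\<And>x. \<bar>\<phi> x\<bar> \<le> M" "\<And>x i. \<bar>frechet_derivative \<phi> (at x) (axis i 1)\<bar> \<le> M"
    "\<phi> \<in> borel_measurable lebesgue"
    "\<And>i. (\<lambda>x. frechet_derivative \<phi> (at x) (axis i 1)) \<in> borel_measurable lebesgue"
    by (metis test_function_bounds[OF \<phi>])
  show "integrable lebesgue (\<lambda>x. f x * \<phi> x)"
    using * by (intro integrable_locally_integrable_mult[OF f, of _ K M])
  show "integrable lebesgue (\<lambda>x. f x * frechet_derivative \<phi> (at x) (axis i 1))"
    using * by (intro integrable_locally_integrable_mult[OF f, of _ K M])
qed

text \<open>The bumps are test functions bounded by $1$ that converge to the indicator of the box, so dominated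
convergence applies.\<close>

lemma integral_box_eq_0:
  fixes g :: "real^'n \<Rightarrow> real"
  assumes g: "locally_integrable g"
    and 0: "\<And>\<phi>. \<phi> \<in> test_functions \<Longrightarrow> (LINT x|lebesgue. g x * \<phi> x) = 0"
  shows "integrable lebesgue (\<lambda>x. g x * indicator (box a b) x)"
    and "(LINT x|lebesgue. g x * indicator (box a b) x) = 0"
proof -
  let ?s = "\<lambda>m x. g x * box_bump a b (real (Suc m)) x"
  note [measurable] = locally_integrable_measurable[OF g]
  have bump: "box_bump a b (real (Suc m)) \<in> test_functions" for m
    by (rule box_bump_test_function) simp
  have w: "integrable lebesgue (\<lambda>x. indicator (cbox a b) x *\<^sub>R g x)"
    using g compact_cbox unfolding locally_integrable_def set_integrable_def by blast
  have m: "(\<lambda>x. g x * indicator (box a b) x) \<in> borel_measurable lebesgue"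
    by (intro borel_measurable_times borel_measurable_indicator locally_integrable_measurable[OF g]) auto
  have ms: "?s i \<in> borel_measurable lebesgue" for i
    using integrable_times_test_function(1)[OF g bump] by auto
  have lim: "AE x in lebesgue. (\<lambda>i. ?s i x) \<longlonglongrightarrow> g x * indicator (box a b) x"
    using box_bump_tendsto by (intro AE_I2 tendsto_intros)
  have bnd: "AE x in lebesgue. norm (?s i x) \<le> \<bar>indicator (cbox a b) x *\<^sub>R g x\<bar>" for i
  proof (rule AE_I2)
    fix x
    show "norm (?s i x) \<le> \<bar>indicator (cbox a b) x *\<^sub>R g x\<bar>"
      using box_bump_bounds[of a b "real (Suc i)" x] box_bump_eq_0[of "real (Suc i)" x a b] box_subset_cbox[of a b]
      by (cases "x \<in> box a b") (auto simp: abs_mult subset_iff intro!: mult_left_le)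
  qed
  have w': "integrable lebesgue (\<lambda>x. \<bar>indicator (cbox a b) x *\<^sub>R g x\<bar>)"
    using w by (rule integrable_abs)
  show "integrable lebesgue (\<lambda>x. g x * indicator (box a b) x)"
    by (rule integrable_dominated_convergence[OF m ms w' lim bnd])
  have "(\<lambda>i. LINT x|lebesgue. ?s i x) \<longlonglongrightarrow> (LINT x|lebesgue. g x * indicator (box a b) x)"
    by (rule integral_dominated_convergence[OF m ms w' lim bnd])
  then show "(LINT x|lebesgue. g x * indicator (box a b) x) = 0"
    using 0[OF bump] by (simp add: LIMSEQ_const_iff)
qed

text \<open>The measures with densities $g^+$ and $g^-$ agree on boxes, which generate the Borel sets and are
stable under intersection. So the measures are equal, and so are their densities almost everywhere.\<close>

lemma fundamental_lemma_calculus_of_variations: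
  fixes g :: "real^'n \<Rightarrow> real"
  assumes g: "locally_integrable g"
    and 0: "\<And>\<phi>. \<phi> \<in> test_functions \<Longrightarrow> (LINT x|lebesgue. g x * \<phi> x) = 0"
  shows "AE x in lebesgue. g x = 0"
proof -
  obtain h where h[measurable]: "h \<in> borel_measurable lborel" and gh: "AE x in lborel. g x = h x"
    using completion_ex_borel_measurable_real[OF locally_integrable_measurable[OF g]] by blast
  have gh': "AE x in lebesgue. g x = h x"
    using gh by (rule AE_completion)
  \<comment> \<open>\<open>ennreal\<close> maps negative numbers to \<open>0\<close>, so \<open>D 1\<close> and \<open>D (- 1)\<close> have the densities $g^+$ and $g^-$ up to null sets.\<close>
  define D where "D = (\<lambda>s. density lborel (\<lambda>x. ennreal (s * h x)))"
  have D: "emeasure (D s) (box a b) = (\<integral>\<^sup>+x. ennreal (s * (g x * indicator (box a b) x)) \<partial>lebesgue)" for a b s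
  proof -
    have "emeasure (D s) (box a b) = (\<integral>\<^sup>+x. ennreal (s * h x) * indicator (box a b) x \<partial>lebesgue)"
      by (simp add: D_def emeasure_density nn_integral_completion)
    also have "\<dots> = (\<integral>\<^sup>+x. ennreal (s * (g x * indicator (box a b) x)) \<partial>lebesgue)"
      by (rule nn_integral_cong_AE) (use gh' in \<open>auto simp: indicator_def\<close>)
    finally show ?thesis .
  qed
  have fin: "emeasure (D s) (box a b) \<noteq> \<infinity>" if "s = 1 \<or> s = -1" for a b s
    using integral_box_eq_0(1)[OF g 0, of a b] that unfolding D real_integrable_def by auto
  have "D 1 = D (-1)"
  proof (rule measure_eqI_generator_eq)
    show "Int_stable (range (\<lambda>(a, b). box a b :: (real^'n) set))"
      by (auto simp: Int_stable_def box_Int_box)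
    show "emeasure (D 1) X = emeasure (D (-1)) X" if E: "X \<in> range (\<lambda>(a, b). box a b)" for X
    proof -
      obtain a b where X: "X = box a b" using E by auto
      have "enn2real (emeasure (D 1) X) = enn2real (emeasure (D (-1)) X)"
        using integral_box_eq_0(2)[OF g 0, of a b] integral_box_eq_0(1)[OF g 0, of a b]
        unfolding X D by (simp add: real_lebesgue_integral_def)
      then have "ennreal (enn2real (emeasure (D 1) X)) = ennreal (enn2real (emeasure (D (-1)) X))"
        by (rule arg_cong)
      moreover have "emeasure (D 1) X < top" "emeasure (D (-1)) X < top"
        using fin[of 1 a b] fin[of "-1" a b] X by (auto simp: less_top)
      ultimately show ?thesis
        by (simp only: ennreal_enn2real)
    qed
    show "sets (D 1) = sigma_sets UNIV (range (\<lambda>(a, b). box a b))"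
      "sets (D (-1)) = sigma_sets UNIV (range (\<lambda>(a, b). box a b))"
      by (auto simp: D_def borel_eq_box)
    show "range (\<lambda>n. box (- (real n *\<^sub>R One)) (real n *\<^sub>R One)) \<subseteq> range (\<lambda>(a, b). box a b :: (real^'n) set)"
      by auto
    show "(\<Union>n. box (- (real n *\<^sub>R One)) (real n *\<^sub>R One)) = (UNIV :: (real^'n) set)"
      using UN_box_eq_UNIV by simp
    show "emeasure (D 1) (box (- (real n *\<^sub>R One)) (real n *\<^sub>R One)) \<noteq> \<infinity>" for n
      using fin by auto
  qed auto
  then have "AE x in lborel. ennreal (1 * h x) = ennreal (-1 * h x)"
    unfolding D_def by (intro sigma_finite_measure.density_unique[OF sigma_finite_lborel]) auto
  then have "AE x in lborel. h x = 0"
  proof (rule eventually_mono)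
    fix x assume eq: "ennreal (1 * h x) = ennreal (-1 * h x)"
    show "h x = 0"
      using eq by (cases "h x \<ge> 0") (auto simp: ennreal_neg)
  qed
  then have "AE x in lebesgue. h x = 0" by (rule AE_completion)
  with gh' show ?thesis by eventually_elim simp
qed

lemma has_weak_gradient_unique:
  assumes "has_weak_gradient f g" "has_weak_gradient f g'"
  shows "AE x in lebesgue. g x = g' x"
proof -
  have "AE x in lebesgue. g x $ i - g' x $ i = 0" for i
  proof (rule fundamental_lemma_calculus_of_variations)
    have li: "locally_integrable (\<lambda>x. g x $ i)" "locally_integrable (\<lambda>x. g' x $ i)"
      using assms by (auto simp: has_weak_gradient_def intro: locally_integrable_componentwise)
    then show "locally_integrable (\<lambda>x. g x $ i - g' x $ i)"
      by (rule locally_integrable_diff)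
    fix \<phi> :: "real^'a \<Rightarrow> real" assume \<phi>: "\<phi> \<in> test_functions"
    have "(LINT x|lebesgue. g x $ i * \<phi> x) = (LINT x|lebesgue. g' x $ i * \<phi> x)"
      using bspec[OF conjunct2[OF conjunct2[OF assms(1)[unfolded has_weak_gradient_def]]] \<phi>]
        bspec[OF conjunct2[OF conjunct2[OF assms(2)[unfolded has_weak_gradient_def]]] \<phi>] by simp
    then show "(LINT x|lebesgue. (g x $ i - g' x $ i) * \<phi> x) = 0"
      using li[THEN integrable_times_test_function(1), OF \<phi>] by (simp add: left_diff_distrib)
  qed
  then have "AE x in lebesgue. \<forall>i. g x $ i - g' x $ i = 0"
    by (simp add: AE_all_countable)
  then show ?thesis
    by eventually_elim (simp add: vec_eq_iff)
qed

lemma has_weak_gradient_add: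
  assumes "has_weak_gradient f g" "has_weak_gradient f' g'"
  shows "has_weak_gradient (\<lambda>x. f x + f' x) (\<lambda>x. g x + g' x)"
  unfolding has_weak_gradient_def
proof (intro conjI ballI allI)
  have li: "locally_integrable f" "locally_integrable f'" "locally_integrable g" "locally_integrable g'"
    using assms by (auto simp: has_weak_gradient_def)
  then show "locally_integrable (\<lambda>x. f x + f' x)" "locally_integrable (\<lambda>x. g x + g' x)"
    by (auto intro: locally_integrable_add)
  fix \<phi> :: "real^'a \<Rightarrow> real" and i assume \<phi>: "\<phi> \<in> test_functions"
  have "(LINT x|lebesgue. f x * frechet_derivative \<phi> (at x) (axis i 1)) = - (LINT x|lebesgue. g x $ i * \<phi> x)"
    "(LINT x|lebesgue. f' x * frechet_derivative \<phi> (at x) (axis i 1)) = - (LINT x|lebesgue. g' x $ i * \<phi> x)"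
    using assms \<phi> unfolding has_weak_gradient_def by blast+
  then show "(LINT x|lebesgue. (f x + f' x) * frechet_derivative \<phi> (at x) (axis i 1)) =
      - (LINT x|lebesgue. (g x + g' x) $ i * \<phi> x)"
    using li(1,2)[THEN integrable_times_test_function(2), OF \<phi>]
      li(3,4)[THEN locally_integrable_componentwise, THEN integrable_times_test_function(1), OF \<phi>]
    by (simp add: distrib_right)
qed

lemma has_weak_gradient_scaleR:
  assumes "has_weak_gradient f g"
  shows "has_weak_gradient (\<lambda>x. c * f x) (\<lambda>x. c *\<^sub>R g x)"
  unfolding has_weak_gradient_def
proof (intro conjI ballI allI)
  show "locally_integrable (\<lambda>x. c * f x)" "locally_integrable (\<lambda>x. c *\<^sub>R g x)"
    using assms locally_integrable_scaleR[of f c] locally_integrable_scaleR[of g c]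
    by (auto simp: has_weak_gradient_def)
  fix \<phi> :: "real^'a \<Rightarrow> real" and i assume "\<phi> \<in> test_functions"
  then have "(LINT x|lebesgue. f x * frechet_derivative \<phi> (at x) (axis i 1)) = - (LINT x|lebesgue. g x $ i * \<phi> x)"
    using assms unfolding has_weak_gradient_def by blast
  then show "(LINT x|lebesgue. c * f x * frechet_derivative \<phi> (at x) (axis i 1)) =
      - (LINT x|lebesgue. (c *\<^sub>R g x) $ i * \<phi> x)"
    by (simp add: mult.assoc)
qed

lemma has_weak_gradient_0: "has_weak_gradient (\<lambda>x. 0) (\<lambda>x. 0)"
  by (simp add: has_weak_gradient_def locally_integrable_def set_integrable_def)

lemma has_weak_gradient_weak_gradient:
  "weakly_differentiable f \<Longrightarrow> has_weak_gradient f (weak_gradient f)"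
  unfolding weakly_differentiable_def weak_gradient_def by (rule someI_ex[where P="has_weak_gradient f"])

text \<open>By uniqueness any weak gradient computes the energy, whichever one is chosen in its definition.\<close>

lemma dirichlet_energy_eq:
  assumes "has_weak_gradient f g"
  shows "dirichlet_energy f = (\<integral>\<^sup>+x. ennreal ((norm (g x))\<^sup>2) \<partial>lebesgue)"
proof -
  have "AE x in lebesgue. weak_gradient f x = g x"
    by (rule has_weak_gradient_unique[OF has_weak_gradient_weak_gradient assms])
      (use assms in \<open>auto simp: weakly_differentiable_def\<close>)
  then show ?thesis
    unfolding dirichlet_energy_def by (intro nn_integral_cong_AE) auto
qed

section \<open>Convexity, homogeneity and lower semicontinuity of the Coulomb energy\<close>

lemma riesz_potential_pos_const:
  assumes "0 < \<beta>" "\<beta> < real CARD('n)"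
  shows "\<exists>A>0. \<forall>x::real^'n::finite. riesz_potential \<beta> x = A * norm x powr - (real CARD('n) - \<beta>)"
  using assms unfolding riesz_potential_def
  by (intro exI[of _ "Gamma ((real CARD('n) - \<beta>) / 2) /
      (Gamma (\<beta> / 2) * pi powr (real CARD('n) / 2) * 2 powr \<beta>)"]) (simp add: Gamma_real_pos)

lemma riesz_potential_nonneg:
  assumes "0 < \<beta>" "\<beta> < real CARD('n)"
  shows "0 \<le> riesz_potential \<beta> (x::real^'n::finite)"
  using riesz_potential_pos_const[OF assms] by fastforce

lemma borel_measurable_riesz_potential [measurable]:
  "riesz_potential \<beta> \<in> borel_measurable borel"
  unfolding riesz_potential_def by measurable

lemma riesz_convolution_cong_AE:
  assumes "AE x in lebesgue. f x = g x"
  shows "riesz_convolution \<beta> p f = riesz_convolution \<beta> p g"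
  unfolding riesz_convolution_def using assms
  by (intro ext nn_integral_cong_AE) (auto elim: eventually_mono)

lemma measurable_riesz_integrand:
  fixes f :: "real^'n \<Rightarrow> real"
  assumes "f \<in> borel_measurable lebesgue"
  shows "(\<lambda>y. ennreal (riesz_potential \<beta> (x - y) * \<bar>f y\<bar> powr p)) \<in> borel_measurable lebesgue"
proof -
  have "(\<lambda>y. riesz_potential \<beta> (x - y)) \<in> borel_measurable lebesgue"
    by (intro measurable_completion) measurable
  with assms show ?thesis by measurable
qed

text \<open>A Borel representative of \<open>f\<close> gives the same convolution, and for it Tonelli's theorem provides
measurability.\<close>

lemma borel_measurable_riesz_convolution:
  fixes f :: "real^'n \<Rightarrow> real"
  assumes "f \<in> borel_measurable lebesgue"
  shows "riesz_convolution \<beta> p f \<in> borel_measurable lebesgue"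
proof -
  obtain h where h[measurable]: "h \<in> borel_measurable lborel" and "AE x in lborel. f x = h x"
    using completion_ex_borel_measurable_real[OF assms] by blast
  then have "riesz_convolution \<beta> p f = riesz_convolution \<beta> p h"
    by (intro riesz_convolution_cong_AE AE_completion)
  also have "\<dots> = (\<lambda>x. \<integral>\<^sup>+y. ennreal (riesz_potential \<beta> (x - y) * \<bar>h y\<bar> powr p) \<partial>lborel)"
    by (rule ext) (simp add: riesz_convolution_def nn_integral_completion)
  also have "\<dots> \<in> borel_measurable lborel"
    by measurable
  finally show ?thesis by (rule measurable_completion)
qed

text \<open>Convexity of $x^p$ on the open half-line extends to $x = 0$ because $s^p \le s$ for
$0 \le s \le 1$.\<close>

lemma powr_convex_nonneg:
  fixes x y s t p :: real
  assumes p: "1 \<le> p" and xy: "0 \<le> x" "0 \<le> y" and st: "0 \<le> s" "0 \<le> t" "s + t = 1"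
  shows "(s * x + t * y) powr p \<le> s * x powr p + t * y powr p"
proof -
  have powr_le: "s powr p \<le> s" if "0 \<le> s" "s \<le> 1" for s :: real
    using that p powr_mono'[of 1 p s] by (cases "s = 0") auto
  have zero: "(s * x) powr p \<le> s * x powr p" if "0 \<le> s" "s \<le> 1" "0 \<le> x" for s x :: real
    using that powr_le[of s] by (simp add: powr_mult mult_right_mono)
  consider "x = 0" | "y = 0" | "x > 0" "y > 0" using xy by linarith
  then show ?thesis
  proof cases
    case 1
    then show ?thesis using zero[of t y] st xy by simp
  next
    case 2
    then show ?thesis using zero[of s x] st xy by simp
  next
    case 3
    have s: "s = 1 - t" using st by simp
    show ?thesis
      unfolding s using convex_onD[OF powr_convex[OF p], of t x y] 3 st by simp
  qed
qed

lemma abs_powr_convex: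
  fixes x y s t p :: real
  assumes "1 \<le> p" "0 \<le> s" "0 \<le> t" "s + t = 1"
  shows "\<bar>s * x + t * y\<bar> powr p \<le> s * \<bar>x\<bar> powr p + t * \<bar>y\<bar> powr p"
proof -
  have "\<bar>s * x + t * y\<bar> \<le> s * \<bar>x\<bar> + t * \<bar>y\<bar>"
    using abs_triangle_ineq[of "s * x" "t * y"] assms by (simp add: abs_mult)
  then have "\<bar>s * x + t * y\<bar> powr p \<le> (s * \<bar>x\<bar> + t * \<bar>y\<bar>) powr p"
    using assms by (intro powr_mono2) auto
  also have "\<dots> \<le> s * \<bar>x\<bar> powr p + t * \<bar>y\<bar> powr p"
    using assms by (intro powr_convex_nonneg) auto
  finally show ?thesis .
qed

lemma ennreal_square_convex:
  fixes a b :: ennreal and s t :: real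
  assumes "0 \<le> s" "0 \<le> t" "s + t = 1"
  shows "(ennreal s * a + ennreal t * b)\<^sup>2 \<le> ennreal s * a\<^sup>2 + ennreal t * b\<^sup>2"
proof -
  have top: "ennreal s * a\<^sup>2 = top" if "a = top" "s > 0" for s a
    using that by (simp add: ennreal_mult_top power2_eq_square)
  consider "s = 0" | "t = 0" | "s > 0" "t > 0" "a = top" | "s > 0" "t > 0" "b = top"
    | x y where "a = ennreal x" "0 \<le> x" "b = ennreal y" "0 \<le> y"
    using assms by (metis ennreal_cases le_less)
  then show ?thesis
  proof cases
    case 5
    have st: "t = 1 - s" using assms by simp
    have "s * x\<^sup>2 + t * y\<^sup>2 - (s * x + t * y)\<^sup>2 = s * t * (x - y)\<^sup>2"
      unfolding st by (simp add: power2_eq_square algebra_simps)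
    also have "\<dots> \<ge> 0" using assms by simp
    finally have "(s * x + t * y)\<^sup>2 \<le> s * x\<^sup>2 + t * y\<^sup>2" by simp
    moreover have "(ennreal s * a + ennreal t * b)\<^sup>2 = ennreal ((s * x + t * y)\<^sup>2)"
      using assms 5 by (simp add: ennreal_mult' ennreal_power[symmetric])
    moreover have "ennreal s * a\<^sup>2 + ennreal t * b\<^sup>2 = ennreal (s * x\<^sup>2 + t * y\<^sup>2)"
      using assms 5 by (simp add: ennreal_mult' ennreal_power[symmetric])
    ultimately show ?thesis by (simp add: ennreal_leI)
  qed (use assms top in auto)
qed

text \<open>Convexity passes from $|\cdot|^p$ to the convolution, since the kernel is nonnegative, and then
through the square, which is increasing and convex.\<close>

lemma coulomb_energy_convex:
  fixes f g :: "real^'n \<Rightarrow> real"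
  assumes \<alpha>: "0 < \<alpha>" "\<alpha> < real CARD('n)" and p: "1 \<le> p"
    and m[measurable]: "f \<in> borel_measurable lebesgue" "g \<in> borel_measurable lebesgue"
    and st: "0 \<le> s" "0 \<le> t" "s + t = 1"
  shows "coulomb_energy \<alpha> p (\<lambda>x. s * f x + t * g x) \<le>
    ennreal s * coulomb_energy \<alpha> p f + ennreal t * coulomb_energy \<alpha> p g"
proof -
  let ?R = "riesz_convolution (\<alpha> / 2) p :: (real^'n \<Rightarrow> real) \<Rightarrow> _"
  have I: "0 \<le> riesz_potential (\<alpha> / 2) (z :: real^'n)" for z
    using \<alpha> by (intro riesz_potential_nonneg) auto
  note [measurable] = m[THEN borel_measurable_riesz_convolution] m[THEN measurable_riesz_integrand]
  have conv: "?R (\<lambda>x. s * f x + t * g x) x \<le> ennreal s * ?R f x + ennreal t * ?R g x" for x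
  proof -
    have "?R (\<lambda>x. s * f x + t * g x) x \<le>
      (\<integral>\<^sup>+y. (ennreal s * ennreal (riesz_potential (\<alpha> / 2) (x - y) * \<bar>f y\<bar> powr p) +
        ennreal t * ennreal (riesz_potential (\<alpha> / 2) (x - y) * \<bar>g y\<bar> powr p)) \<partial>lebesgue)"
      unfolding riesz_convolution_def
    proof (rule nn_integral_mono)
      fix y
      have "riesz_potential (\<alpha> / 2) (x - y) * \<bar>s * f y + t * g y\<bar> powr p \<le>
          riesz_potential (\<alpha> / 2) (x - y) * (s * \<bar>f y\<bar> powr p + t * \<bar>g y\<bar> powr p)"
        using I abs_powr_convex[OF p st] by (rule mult_left_mono[rotated])
      also have "\<dots> = s * (riesz_potential (\<alpha> / 2) (x - y) * \<bar>f y\<bar> powr p) +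
          t * (riesz_potential (\<alpha> / 2) (x - y) * \<bar>g y\<bar> powr p)"
        by (simp add: algebra_simps)
      finally show "ennreal (riesz_potential (\<alpha> / 2) (x - y) * \<bar>s * f y + t * g y\<bar> powr p) \<le>
          ennreal s * ennreal (riesz_potential (\<alpha> / 2) (x - y) * \<bar>f y\<bar> powr p) +
          ennreal t * ennreal (riesz_potential (\<alpha> / 2) (x - y) * \<bar>g y\<bar> powr p)"
        using st I by (simp add: ennreal_mult[symmetric] ennreal_plus[symmetric] ennreal_leI del: ennreal_plus)
    qed
    also have "\<dots> = ennreal s * ?R f x + ennreal t * ?R g x"
      unfolding riesz_convolution_def by (subst nn_integral_add) (auto simp: nn_integral_cmult)
    finally show ?thesis .
  qed
  have "coulomb_energy \<alpha> p (\<lambda>x. s * f x + t * g x) \<le>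
      (\<integral>\<^sup>+x. (ennreal s * (?R f x)\<^sup>2 + ennreal t * (?R g x)\<^sup>2) \<partial>lebesgue)"
    unfolding coulomb_energy_def
  proof (rule nn_integral_mono)
    fix x
    have "(?R (\<lambda>x. s * f x + t * g x) x)\<^sup>2 \<le> (ennreal s * ?R f x + ennreal t * ?R g x)\<^sup>2"
      using conv by (intro power_mono) auto
    then show "(?R (\<lambda>x. s * f x + t * g x) x)\<^sup>2 \<le> ennreal s * (?R f x)\<^sup>2 + ennreal t * (?R g x)\<^sup>2"
      using ennreal_square_convex[OF st] order_trans by blast
  qed
  also have "\<dots> = ennreal s * coulomb_energy \<alpha> p f + ennreal t * coulomb_energy \<alpha> p g"
    unfolding coulomb_energy_def by (subst nn_integral_add) (auto simp: nn_integral_cmult)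
  finally show ?thesis .
qed

lemma coulomb_energy_scale:
  fixes f :: "real^'n \<Rightarrow> real"
  assumes \<alpha>: "0 < \<alpha>" "\<alpha> < real CARD('n)"
    and m[measurable]: "f \<in> borel_measurable lebesgue"
  shows "coulomb_energy \<alpha> p (\<lambda>x. c * f x) = ennreal (\<bar>c\<bar> powr (2 * p)) * coulomb_energy \<alpha> p f"
proof -
  let ?R = "riesz_convolution (\<alpha> / 2) p :: (real^'n \<Rightarrow> real) \<Rightarrow> _"
  note [measurable] = m[THEN borel_measurable_riesz_convolution] m[THEN measurable_riesz_integrand]
  have I: "0 \<le> riesz_potential (\<alpha> / 2) (z :: real^'n)" for z
    using \<alpha> by (intro riesz_potential_nonneg) auto
  have R: "?R (\<lambda>x. c * f x) x = ennreal (\<bar>c\<bar> powr p) * ?R f x" for x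
  proof -
    have "ennreal (riesz_potential (\<alpha> / 2) (x - y) * \<bar>c * f y\<bar> powr p) =
        ennreal (\<bar>c\<bar> powr p) * ennreal (riesz_potential (\<alpha> / 2) (x - y) * \<bar>f y\<bar> powr p)" for y
      using I by (simp add: abs_mult powr_mult ennreal_mult[symmetric] mult_ac)
    then show ?thesis
      unfolding riesz_convolution_def by (simp add: nn_integral_cmult)
  qed
  have "(\<bar>c\<bar> powr p)\<^sup>2 = \<bar>c\<bar> powr (2 * p)"
    by (simp add: power2_eq_square powr_add[symmetric])
  then have "(ennreal (\<bar>c\<bar> powr p) * ?R f x)\<^sup>2 = ennreal (\<bar>c\<bar> powr (2 * p)) * (?R f x)\<^sup>2" for x
    by (simp add: power_mult_distrib ennreal_power)
  then show ?thesis
    unfolding coulomb_energy_def R by (simp add: nn_integral_cmult)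
qed

lemma Fatou_AE:
  assumes [measurable]: "\<And>n. u n \<in> borel_measurable M"
    and lim: "AE x in M. (\<lambda>n. u n x) \<longlonglongrightarrow> (v x :: ennreal)"
  shows "(\<integral>\<^sup>+x. v x \<partial>M) \<le> liminf (\<lambda>n. \<integral>\<^sup>+x. u n x \<partial>M)"
proof -
  have "(\<integral>\<^sup>+x. v x \<partial>M) = (\<integral>\<^sup>+x. liminf (\<lambda>n. u n x) \<partial>M)"
    using lim by (intro nn_integral_cong_AE) (auto elim!: eventually_mono dest: lim_imp_Liminf[rotated])
  also have "\<dots> \<le> liminf (\<lambda>n. \<integral>\<^sup>+x. u n x \<partial>M)"
    by (rule nn_integral_liminf) simp
  finally show ?thesis .
qed

lemma nn_integral_le_of_AE_tendsto:
  assumes m: "\<And>n. u n \<in> borel_measurable M"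
    and lim: "AE x in M. (\<lambda>n. u n x) \<longlonglongrightarrow> (v x :: ennreal)"
    and le: "eventually (\<lambda>n. (\<integral>\<^sup>+x. u n x \<partial>M) \<le> C) sequentially"
  shows "(\<integral>\<^sup>+x. v x \<partial>M) \<le> C"
proof -
  have "liminf (\<lambda>n. \<integral>\<^sup>+x. u n x \<partial>M) \<le> limsup (\<lambda>n. \<integral>\<^sup>+x. u n x \<partial>M)"
    by (intro Liminf_le_Limsup) simp
  also have "\<dots> \<le> C" using le by (rule Limsup_bounded)
  finally show ?thesis using Fatou_AE[OF m lim] by simp
qed

lemma liminf_ennreal_power2:
  fixes a :: "nat \<Rightarrow> ennreal"
  shows "(liminf a)\<^sup>2 = liminf (\<lambda>n. (a n)\<^sup>2)"
proof (rule Liminf_compose_continuous_mono[symmetric])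
  show "continuous_on UNIV (\<lambda>x::ennreal. x\<^sup>2)"
    unfolding continuous_on_def power2_eq_square
    by (auto intro!: tendsto_mult_ennreal)
qed (auto intro!: power_mono simp: mono_def)

text \<open>Fatou's lemma is used twice: for the inner integral at each point, and for the outer integral of the
square.\<close>

lemma coulomb_energy_le_of_AE_tendsto:
  fixes f :: "nat \<Rightarrow> real^'n \<Rightarrow> real"
  assumes \<alpha>: "0 < \<alpha>" "\<alpha> < real CARD('n)" and p: "1 \<le> p"
    and m[measurable]: "\<And>n. f n \<in> borel_measurable lebesgue"
    and lim: "AE x in lebesgue. (\<lambda>n. f n x) \<longlonglongrightarrow> g x"
    and le: "eventually (\<lambda>n. coulomb_energy \<alpha> p (f n) \<le> C) sequentially"
  shows "coulomb_energy \<alpha> p g \<le> C"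
proof -
  let ?R = "riesz_convolution (\<alpha> / 2) p :: (real^'n \<Rightarrow> real) \<Rightarrow> _"
  have "?R g x \<le> liminf (\<lambda>n. ?R (f n) x)" for x
    unfolding riesz_convolution_def
  proof (rule Fatou_AE)
    show "AE y in lebesgue. (\<lambda>n. ennreal (riesz_potential (\<alpha> / 2) (x - y) * \<bar>f n y\<bar> powr p)) \<longlonglongrightarrow>
        ennreal (riesz_potential (\<alpha> / 2) (x - y) * \<bar>g y\<bar> powr p)"
      using lim
    proof eventually_elim
      case (elim y)
      have "(\<lambda>n. \<bar>f n y\<bar> powr p) \<longlonglongrightarrow> \<bar>g y\<bar> powr p"
        using p by (intro tendsto_powr2 tendsto_rabs[OF elim] tendsto_const) auto
      then show ?case by (intro tendsto_ennrealI tendsto_mult tendsto_const)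
    qed
  qed (rule measurable_riesz_integrand[OF m])
  then have "(?R g x)\<^sup>2 \<le> liminf (\<lambda>n. (?R (f n) x)\<^sup>2)" for x
    unfolding liminf_ennreal_power2[symmetric] by (intro power_mono) auto
  then have "coulomb_energy \<alpha> p g \<le> (\<integral>\<^sup>+x. liminf (\<lambda>n. (?R (f n) x)\<^sup>2) \<partial>lebesgue)"
    unfolding coulomb_energy_def by (intro nn_integral_mono)
  also have "\<dots> \<le> liminf (\<lambda>n. coulomb_energy \<alpha> p (f n))"
    unfolding coulomb_energy_def using m[THEN borel_measurable_riesz_convolution]
    by (intro nn_integral_liminf) measurable
  also have "\<dots> \<le> limsup (\<lambda>n. coulomb_energy \<alpha> p (f n))"
    by (intro Liminf_le_Limsup) simp
  also have "\<dots> \<le> C" using le by (rule Limsup_bounded)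
  finally show ?thesis .
qed

section \<open>Energies control local $L^1$ norms\<close>

definition ball_L1 :: "real \<Rightarrow> (real^'n \<Rightarrow> 'b::real_normed_vector) \<Rightarrow> ennreal" where
  "ball_L1 R f = (\<integral>\<^sup>+x\<in>ball 0 R. ennreal (norm (f x)) \<partial>lebesgue)"

lemma ball_lebesgue [measurable]: "ball (x::real^'n) R \<in> sets lebesgue"
  by simp

lemma ball_L1_triangle:
  fixes f g :: "real^'n \<Rightarrow> 'b::{banach, second_countable_topology}"
  assumes [measurable]: "f \<in> borel_measurable lebesgue" "g \<in> borel_measurable lebesgue"
  shows "ball_L1 R (\<lambda>x. f x + g x) \<le> ball_L1 R f + ball_L1 R g"
proof -
  have "ball_L1 R (\<lambda>x. f x + g x) \<le>
      (\<integral>\<^sup>+x. ennreal (norm (f x)) * indicator (ball 0 R) x + ennreal (norm (g x)) * indicator (ball 0 R) x \<partial>lebesgue)"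
    unfolding ball_L1_def
    by (intro nn_integral_mono)
      (auto simp: indicator_def norm_triangle_ineq ennreal_plus[symmetric] ennreal_leI simp del: ennreal_plus)
  also have "\<dots> = ball_L1 R f + ball_L1 R g"
    unfolding ball_L1_def by (intro nn_integral_add) measurable
  finally show ?thesis .
qed

text \<open>Pointwise, $a \le 1 + a^p$. This crude bound suffices in place of Hoelder's inequality, as
homogeneity restores the right scaling.\<close>

lemma ball_L1_le_of_powr:
  fixes f :: "real^'n \<Rightarrow> 'b::{banach, second_countable_topology}"
  assumes m[measurable]: "f \<in> borel_measurable lebesgue" and p: "1 \<le> p"
  shows "ball_L1 R f \<le> emeasure lebesgue (ball (0::real^'n) R) +
    (\<integral>\<^sup>+x\<in>ball 0 R. ennreal (norm (f x) powr p) \<partial>lebesgue)"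
proof -
  have *: "ennreal a \<le> 1 + ennreal (a powr p)" if "0 \<le> a" for a :: real
  proof -
    have "a \<le> 1 + a powr p"
    proof (cases "a \<le> 1")
      case True
      then show ?thesis using powr_ge_zero[of a p] by linarith
    next
      case False
      then show ?thesis using powr_mono[OF p, of a] by simp
    qed
    then have "ennreal a \<le> ennreal (1 + a powr p)" by (rule ennreal_leI)
    then show ?thesis by simp
  qed
  have "ball_L1 R f \<le> (\<integral>\<^sup>+x. indicator (ball 0 R) x +
      ennreal (norm (f x) powr p) * indicator (ball 0 R) x \<partial>lebesgue)"
    unfolding ball_L1_def by (intro nn_integral_mono) (use * in \<open>auto simp: indicator_def\<close>)
  also have "\<dots> = emeasure lebesgue (ball (0::real^'n) R) +
      (\<integral>\<^sup>+x\<in>ball 0 R. ennreal (norm (f x) powr p) \<partial>lebesgue)"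
    by (subst nn_integral_add) auto
  finally show ?thesis .
qed

lemma ball_L1_scaleR:
  fixes f :: "real^'n \<Rightarrow> 'b::{banach, second_countable_topology}"
  assumes [measurable]: "f \<in> borel_measurable lebesgue"
  shows "ball_L1 R (\<lambda>x. c *\<^sub>R f x) = ennreal \<bar>c\<bar> * ball_L1 R f"
  unfolding ball_L1_def by (simp add: ennreal_mult mult.assoc nn_integral_cmult)

text \<open>The crude bound is applied to $g/t$, whose square integral is at most $1$.\<close>

lemma square_integral_controls_ball_L1:
  fixes g :: "real^'n \<Rightarrow> 'b::{banach, second_countable_topology}"
  assumes m[measurable]: "g \<in> borel_measurable lebesgue" and t: "0 < t"
    and le: "(\<integral>\<^sup>+x. ennreal ((norm (g x))\<^sup>2) \<partial>lebesgue) \<le> ennreal (t\<^sup>2)"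
  shows "ball_L1 R g \<le> ennreal t * (emeasure lebesgue (ball (0::real^'n) R) + 1)"
proof -
  let ?h = "\<lambda>x. (1 / t) *\<^sub>R g x"
  have "(\<integral>\<^sup>+x\<in>ball 0 R. ennreal (norm (?h x) powr 2) \<partial>lebesgue) \<le>
      (\<integral>\<^sup>+x. ennreal ((1 / t)\<^sup>2) * ennreal ((norm (g x))\<^sup>2) \<partial>lebesgue)"
    by (intro nn_integral_mono)
      (auto simp: indicator_def ennreal_mult[symmetric] power_divide t less_imp_le)
  also have "\<dots> \<le> ennreal ((1 / t)\<^sup>2) * ennreal (t\<^sup>2)"
    using le by (subst nn_integral_cmult) (auto intro: mult_left_mono)
  also have "\<dots> = 1"
    using t by (simp add: ennreal_mult[symmetric] power_divide)
  finally have "ball_L1 R ?h \<le> emeasure lebesgue (ball (0::real^'n) R) + 1"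
    using ball_L1_le_of_powr[of ?h 2 R] by (auto intro: order_trans add_left_mono)
  moreover have "ball_L1 R g = ennreal t * ball_L1 R ?h"
    using ball_L1_scaleR[of ?h R t] t by simp
  ultimately show ?thesis by (simp add: mult_left_mono)
qed

text \<open>For two points of the ball of radius $R$ the kernel is at least its value at distance $2R$, except on
the diagonal, which is a null set. So the convolution is at least a constant on the ball.\<close>

lemma coulomb_energy_lower_bound:
  assumes \<alpha>: "0 < \<alpha>" "\<alpha> < real CARD('n)" and R: "0 < R"
  obtains c where "0 < c" "\<And>f :: real^'n \<Rightarrow> real. f \<in> borel_measurable lebesgue \<Longrightarrow>
    (ennreal c * (\<integral>\<^sup>+x\<in>ball 0 R. ennreal (\<bar>f x\<bar> powr p) \<partial>lebesgue))\<^sup>2 *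
      emeasure lebesgue (ball (0::real^'n) R) \<le> coulomb_energy \<alpha> p f"
proof -
  let ?e = "- (real CARD('n) - \<alpha> / 2)"
  obtain A where A: "A > 0" "\<And>x::real^'n. riesz_potential (\<alpha> / 2) x = A * norm x powr ?e"
    using riesz_potential_pos_const[of "\<alpha> / 2", where 'n='n] \<alpha> by auto
  \<comment> \<open>Two points of the ball are at distance at most \<open>2 * R\<close>, and the kernel decreases with the distance.\<close>
  define c where "c = A * (2 * R) powr ?e"
  have c: "c > 0" using A R by (simp add: c_def)
  have low: "c \<le> riesz_potential (\<alpha> / 2) (x - y)"
    if "x \<in> ball 0 R" "y \<in> ball 0 R" "y \<noteq> x" for x y :: "real^'n"
  proof -
    have "norm (x - y) \<le> 2 * R"
      using that norm_triangle_ineq4[of x y] by simp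
    then have "(2 * R) powr ?e \<le> norm (x - y) powr ?e"
      using that \<alpha> by (intro powr_mono2') auto
    then show ?thesis unfolding A c_def using A by simp
  qed
  show ?thesis
  proof (rule that[OF c])
    fix f :: "real^'n \<Rightarrow> real" assume m[measurable]: "f \<in> borel_measurable lebesgue"
    let ?J = "\<integral>\<^sup>+x\<in>ball 0 R. ennreal (\<bar>f x\<bar> powr p) \<partial>lebesgue"
    have conv: "ennreal c * ?J \<le> riesz_convolution (\<alpha> / 2) p f x" if x: "x \<in> ball 0 R" for x
    proof -
      have "ennreal c * ?J = (\<integral>\<^sup>+y. ennreal c * (ennreal (\<bar>f y\<bar> powr p) * indicator (ball 0 R) y) \<partial>lebesgue)"
        by (rule nn_integral_cmult[symmetric]) measurable
      also have "\<dots> \<le> (\<integral>\<^sup>+y. ennreal (riesz_potential (\<alpha> / 2) (x - y) * \<bar>f y\<bar> powr p) \<partial>lebesgue)"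
      proof (rule nn_integral_mono_AE)
        have "AE y in lebesgue. y \<noteq> x"
          by (intro AE_completion AE_lborel_singleton)
        then show "AE y in lebesgue. ennreal c * (ennreal (\<bar>f y\<bar> powr p) * indicator (ball 0 R) y) \<le>
            ennreal (riesz_potential (\<alpha> / 2) (x - y) * \<bar>f y\<bar> powr p)"
        proof eventually_elim
          case (elim y)
          show ?case
          proof (cases "y \<in> ball 0 R")
            case True
            then show ?thesis
              using low[OF x True elim] c
              by (simp add: ennreal_mult[symmetric] ennreal_leI mult_right_mono)
          qed simp
        qed
      qed
      finally show ?thesis unfolding riesz_convolution_def .
    qed
    have "(ennreal c * ?J)\<^sup>2 * emeasure lebesgue (ball (0::real^'n) R) =
        (\<integral>\<^sup>+x. (ennreal c * ?J)\<^sup>2 * indicator (ball (0::real^'n) R) x \<partial>lebesgue)"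
      by (rule nn_integral_cmult_indicator[symmetric]) measurable
    also have "\<dots> \<le> coulomb_energy \<alpha> p f"
      unfolding coulomb_energy_def
    proof (rule nn_integral_mono)
      fix x :: "real^'n"
      show "(ennreal c * ?J)\<^sup>2 * indicator (ball 0 R) x \<le> (riesz_convolution (\<alpha> / 2) p f x)\<^sup>2"
        using power_mono[OF conv, of x 2] by (cases "x \<in> ball 0 R") auto
    qed
    finally show "(ennreal c * ?J)\<^sup>2 * emeasure lebesgue (ball (0::real^'n) R) \<le> coulomb_energy \<alpha> p f" .
  qed
qed

text \<open>For energy at most $1$ the lower bound controls the integral of $|f|^p$ over the ball and hence that of
$|f|$; the general case follows by scaling $f$ to $f/t$.\<close>

lemma coulomb_energy_controls_ball_L1:
  assumes \<alpha>: "0 < \<alpha>" "\<alpha> < real CARD('n)" and p: "1 \<le> p" and R: "0 < R"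
  obtains K where "0 \<le> K" "\<And>(f :: real^'n \<Rightarrow> real) t. f \<in> borel_measurable lebesgue \<Longrightarrow> 0 < t \<Longrightarrow>
    coulomb_energy \<alpha> p f \<le> ennreal (t powr (2 * p)) \<Longrightarrow> ball_L1 R f \<le> ennreal (t * K)"
proof -
  obtain c where c: "0 < c" "\<And>f :: real^'n \<Rightarrow> real. f \<in> borel_measurable lebesgue \<Longrightarrow>
    (ennreal c * (\<integral>\<^sup>+x\<in>ball 0 R. ennreal (\<bar>f x\<bar> powr p) \<partial>lebesgue))\<^sup>2 *
      emeasure lebesgue (ball (0::real^'n) R) \<le> coulomb_energy \<alpha> p f"
    by (rule coulomb_energy_lower_bound[OF \<alpha> R, where p=p]) blast
  define v where "v = measure lebesgue (ball (0::real^'n) R)"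
  have v: "v > 0" "emeasure lebesgue (ball (0::real^'n) R) = ennreal v"
    using content_ball_pos[OF R, of "0::real^'n"] emeasure_lborel_ball_finite[of "0::real^'n" R]
    by (auto simp: v_def emeasure_eq_ennreal_measure)
  \<comment> \<open>This solves $(c\,C)^2 v = 1$.\<close>
  define C where "C = 1 / (c * sqrt v)"
  have C: "C > 0" using c v by (simp add: C_def)
  have unit: "ball_L1 R f \<le> ennreal (v + C)"
    if m: "f \<in> borel_measurable lebesgue" and 1: "coulomb_energy \<alpha> p f \<le> 1" for f :: "real^'n \<Rightarrow> real"
  proof -
    let ?J = "\<integral>\<^sup>+x\<in>ball 0 R. ennreal (\<bar>f x\<bar> powr p) \<partial>lebesgue"
    have J: "(ennreal c * ?J)\<^sup>2 * ennreal v \<le> 1"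
      using c(2)[OF m] 1 v by simp
    have "?J \<le> ennreal C"
    proof (cases ?J)
      case (real j)
      then have "(c * j)\<^sup>2 * v \<le> 1"
        using J c v by (simp add: ennreal_mult[symmetric] ennreal_power)
      then have "(c * j * sqrt v)\<^sup>2 \<le> 1\<^sup>2"
        using v by (simp add: power_mult_distrib)
      then have "c * j * sqrt v \<le> 1"
        by (rule power2_le_imp_le) simp
      then have "j \<le> C"
        using c v by (simp add: C_def field_simps)
      with real show ?thesis by (simp add: ennreal_leI)
    next
      case top
      then have "(ennreal c * ?J)\<^sup>2 * ennreal v = top"
        using c v by (simp add: ennreal_mult_top ennreal_top_mult power2_eq_square)
      with J show ?thesis by (simp add: top_unique)
    qed
    then have "ball_L1 R f \<le> ennreal v + ennreal C"
      using ball_L1_le_of_powr[OF m p, of R] v by (auto intro: order_trans add_left_mono)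
    then show ?thesis using v C by simp
  qed
  show ?thesis
  proof (rule that)
    show "0 \<le> v + C" using v C by simp
    fix f :: "real^'n \<Rightarrow> real" and t :: real
    assume m: "f \<in> borel_measurable lebesgue" and t: "0 < t"
      and E: "coulomb_energy \<alpha> p f \<le> ennreal (t powr (2 * p))"
    let ?h = "\<lambda>x. (1 / t) * f x"
    have mh: "?h \<in> borel_measurable lebesgue" using m by simp
    have "coulomb_energy \<alpha> p ?h \<le> ennreal (\<bar>1 / t\<bar> powr (2 * p)) * ennreal (t powr (2 * p))"
      unfolding coulomb_energy_scale[OF \<alpha> m] using E by (rule mult_left_mono) simp
    also have "\<dots> = 1"
      using t by (simp add: ennreal_mult[symmetric] powr_mult[symmetric])
    finally have "ball_L1 R ?h \<le> ennreal (v + C)" by (rule unit[OF mh])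
    moreover have "ball_L1 R f = ennreal t * ball_L1 R ?h"
      using ball_L1_scaleR[OF mh, of R t] t by simp
    ultimately show "ball_L1 R f \<le> ennreal (t * (v + C))"
      using t by (simp add: ennreal_mult' mult_left_mono)
  qed
qed

section \<open>Local $L^1$ completeness and limits of weak gradients\<close>

lemma locally_integrable_if_ball_L1_finite:
  fixes h :: "real^'n \<Rightarrow> 'b::{banach, second_countable_topology}"
  assumes m[measurable]: "h \<in> borel_measurable lebesgue" and fin: "\<And>R. ball_L1 R h < \<infinity>"
  shows "locally_integrable h"
  unfolding locally_integrable_def set_integrable_def
proof (intro allI impI)
  fix K :: "(real^'n) set" assume K: "compact K"
  then obtain R where R: "K \<subseteq> ball 0 R"
    using bounded_subset_ballD[OF compact_imp_bounded] by blast
  have K' [measurable]: "K \<in> sets lebesgue" using K by (simp add: borel_compact)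
  have "(\<integral>\<^sup>+x. ennreal (norm (indicator K x *\<^sub>R h x)) \<partial>lebesgue) \<le> ball_L1 R h"
    unfolding ball_L1_def using R by (intro nn_integral_mono) (auto simp: indicator_def)
  also have "\<dots> < \<infinity>" by (rule fin)
  finally show "integrable lebesgue (\<lambda>x. indicator K x *\<^sub>R h x)"
    by (intro integrableI_bounded) measurable
qed

text \<open>The sum of the increments is integrable over every ball, so it is finite almost everywhere, and an
absolutely convergent telescoping series converges.\<close>

lemma fast_local_Cauchy_AE_convergent:
  fixes f :: "nat \<Rightarrow> real^'n \<Rightarrow> 'b::{banach, second_countable_topology}"
  assumes m[measurable]: "\<And>k. f k \<in> borel_measurable lebesgue"
    and fast: "\<And>R. \<exists>K. \<forall>k. ball_L1 R (\<lambda>x. f (Suc k) x - f k x) \<le> ennreal (K * (1 / 2) ^ k)"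
  shows "AE x in lebesgue. convergent (\<lambda>k. f k x)"
proof -
  let ?d = "\<lambda>k x. norm (f (Suc k) x - f k x)"
  have "AE x in lebesgue. (\<Sum>k. ennreal (?d k x) * indicator (ball 0 (real n)) x) \<noteq> \<infinity>" for n
  proof (rule nn_integral_noteq_infinite)
    obtain K where K: "\<And>k. ball_L1 (real n) (\<lambda>x. f (Suc k) x - f k x) \<le> ennreal (K * (1 / 2) ^ k)"
      using fast by blast
    have "(\<integral>\<^sup>+x. (\<Sum>k. ennreal (?d k x) * indicator (ball 0 (real n)) x) \<partial>lebesgue) =
        (\<Sum>k. ball_L1 (real n) (\<lambda>x. f (Suc k) x - f k x))"
      unfolding ball_L1_def by (intro nn_integral_suminf) measurable
    also have "\<dots> \<le> (\<Sum>k. ennreal (\<bar>K\<bar> * (1 / 2) ^ k))"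
      by (intro suminf_le order_trans[OF K] ennreal_leI mult_right_mono) auto
    also have "\<dots> = ennreal (\<Sum>k. \<bar>K\<bar> * (1 / 2) ^ k)"
      by (intro suminf_ennreal2 summable_mult summable_geometric) auto
    also have "\<dots> < \<infinity>" by simp
    finally show "(\<integral>\<^sup>+x. (\<Sum>k. ennreal (?d k x) * indicator (ball 0 (real n)) x) \<partial>lebesgue) \<noteq> \<infinity>"
      by simp
  qed measurable
  then have "AE x in lebesgue. \<forall>n. (\<Sum>k. ennreal (?d k x) * indicator (ball 0 (real n)) x) \<noteq> \<infinity>"
    by (simp add: AE_all_countable)
  then show ?thesis
  proof eventually_elim
    case (elim x)
    obtain n where "norm x < real n" using reals_Archimedean2 by blast
    then have "(\<Sum>k. ennreal (?d k x)) \<noteq> top"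
      using elim[rule_format, of n] by simp
    then have "summable (\<lambda>k. ?d k x)"
      by (intro summable_suminf_not_top) auto
    then have "summable (\<lambda>k. f (Suc k) x - f k x)"
      by (rule summable_norm_cancel)
    then have "convergent (\<lambda>n. \<Sum>k<n. f (Suc k) x - f k x)"
      by (simp add: summable_iff_convergent)
    then have "convergent (\<lambda>n. f n x - f 0 x)"
      unfolding sum_lessThan_telescope[of "\<lambda>k. f k x"] .
    then show ?case
      using convergent_add[OF _ convergent_const[of "f 0 x"]] by fastforce
  qed
qed

text \<open>The bound is the partial sum of the geometric series in closed form, which makes the induction on
\<open>j\<close> go through.\<close>

lemma fast_local_Cauchy_distance:
  fixes f :: "nat \<Rightarrow> real^'n \<Rightarrow> 'b::{banach, second_countable_topology}"
  assumes m[measurable]: "\<And>k. f k \<in> borel_measurable lebesgue"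
    and K: "0 \<le> K" "\<And>k. ball_L1 R (\<lambda>x. f (Suc k) x - f k x) \<le> ennreal (K * (1 / 2) ^ k)"
  shows "ball_L1 R (\<lambda>x. f (k + j) x - f k x) \<le> ennreal (2 * K * ((1 / 2) ^ k - (1 / 2) ^ (k + j)))"
proof (induction j)
  case 0
  then show ?case by (simp add: ball_L1_def)
next
  case (Suc j)
  have "ball_L1 R (\<lambda>x. f (k + Suc j) x - f k x) =
      ball_L1 R (\<lambda>x. (f (Suc (k + j)) x - f (k + j) x) + (f (k + j) x - f k x))"
    by simp
  also have "\<dots> \<le> ball_L1 R (\<lambda>x. f (Suc (k + j)) x - f (k + j) x) + ball_L1 R (\<lambda>x. f (k + j) x - f k x)"
    by (rule ball_L1_triangle) measurable
  also have "\<dots> \<le> ennreal (K * (1 / 2) ^ (k + j)) + ennreal (2 * K * ((1 / 2) ^ k - (1 / 2) ^ (k + j)))"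
    by (intro add_mono K Suc)
  also have "\<dots> = ennreal (K * (1 / 2) ^ (k + j) + 2 * K * ((1 / 2) ^ k - (1 / 2) ^ (k + j)))"
    using K(1) by (intro ennreal_plus[symmetric] mult_nonneg_nonneg) (auto simp: power_decreasing)
  also have "K * (1 / 2) ^ (k + j) + 2 * K * ((1 / 2) ^ k - (1 / 2) ^ (k + j)) =
      2 * K * ((1 / 2) ^ k - (1 / 2) ^ (k + Suc j))"
    by (simp add: algebra_simps)
  finally show ?case .
qed

text \<open>The limit is taken pointwise; Fatou's lemma turns the Cauchy bound into a bound for the distance to
the limit.\<close>

lemma fast_local_Cauchy_limit:
  fixes f :: "nat \<Rightarrow> real^'n \<Rightarrow> 'b::{banach, second_countable_topology}"
  assumes li: "\<And>k. locally_integrable (f k)"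
    and fast: "\<And>R. \<exists>K. \<forall>k. ball_L1 R (\<lambda>x. f (Suc k) x - f k x) \<le> ennreal (K * (1 / 2) ^ k)"
  obtains g where "locally_integrable g" "AE x in lebesgue. (\<lambda>k. f k x) \<longlonglongrightarrow> g x"
    "\<And>R. (\<lambda>k. ball_L1 R (\<lambda>x. f k x - g x)) \<longlonglongrightarrow> 0"
proof -
  note m[measurable] = li[THEN locally_integrable_measurable]
  define g where "g x = lim (\<lambda>k. f k x)" for x
  have mg[measurable]: "g \<in> borel_measurable lebesgue"
    unfolding g_def by (rule borel_measurable_lim_metric) (rule m)
  have lim: "AE x in lebesgue. (\<lambda>k. f k x) \<longlonglongrightarrow> g x"
    using fast_local_Cauchy_AE_convergent[OF m fast]
    by eventually_elim (simp add: g_def convergent_LIMSEQ_iff)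
  have dist: "\<exists>K\<ge>0. \<forall>k. ball_L1 R (\<lambda>x. f k x - g x) \<le> ennreal (2 * K * (1 / 2) ^ k)" for R
  proof -
    obtain K0 where K0: "\<And>k. ball_L1 R (\<lambda>x. f (Suc k) x - f k x) \<le> ennreal (K0 * (1 / 2) ^ k)"
      using fast by blast
    have K: "ball_L1 R (\<lambda>x. f (Suc k) x - f k x) \<le> ennreal (\<bar>K0\<bar> * (1 / 2) ^ k)" for k
      by (rule order_trans[OF K0]) (intro ennreal_leI mult_right_mono, auto)
    have "ball_L1 R (\<lambda>x. f k x - g x) \<le> ennreal (2 * \<bar>K0\<bar> * (1 / 2) ^ k)" for k
      unfolding ball_L1_def
    proof (rule nn_integral_le_of_AE_tendsto)
      show "AE x in lebesgue. (\<lambda>j. ennreal (norm (f (k + j) x - f k x)) * indicator (ball 0 R) x)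
          \<longlonglongrightarrow> ennreal (norm (f k x - g x)) * indicator (ball 0 R) x"
        using lim
      proof eventually_elim
        case (elim x)
        have "(\<lambda>j. f (k + j) x) \<longlonglongrightarrow> g x"
          using LIMSEQ_ignore_initial_segment[OF elim, of k] by (simp add: add.commute)
        then have "(\<lambda>j. ennreal (norm (f (k + j) x - f k x))) \<longlonglongrightarrow> ennreal (norm (g x - f k x))"
          by (intro tendsto_ennrealI tendsto_norm tendsto_diff tendsto_const)
        then show ?case
          by (cases "x \<in> ball 0 R") (auto simp: norm_minus_commute)
      qed
      have "ball_L1 R (\<lambda>x. f (k + j) x - f k x) \<le> ennreal (2 * \<bar>K0\<bar> * (1 / 2) ^ k)" for j
        using fast_local_Cauchy_distance[OF m _ K, where k=k and j=j]
        by (rule order_trans) (auto intro!: ennreal_leI mult_left_mono)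
      then show "eventually (\<lambda>j. (\<integral>\<^sup>+x. ennreal (norm (f (k + j) x - f k x)) * indicator (ball 0 R) x \<partial>lebesgue)
          \<le> ennreal (2 * \<bar>K0\<bar> * (1 / 2) ^ k)) sequentially"
        by (simp add: ball_L1_def)
    qed measurable
    then show ?thesis by (intro exI[of _ "\<bar>K0\<bar>"]) auto
  qed
  have "locally_integrable (\<lambda>x. f 0 x - g x)"
  proof (rule locally_integrable_if_ball_L1_finite)
    show "ball_L1 R (\<lambda>x. f 0 x - g x) < \<infinity>" for R
      using dist[of R] by (metis ennreal_less_top infinity_ennreal_def order_le_less_trans)
  qed measurable
  from locally_integrable_diff[OF li[of 0] this] have "locally_integrable g" by simp
  moreover have "(\<lambda>k. ball_L1 R (\<lambda>x. f k x - g x)) \<longlonglongrightarrow> 0" for R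
  proof -
    obtain K where K: "\<And>k. ball_L1 R (\<lambda>x. f k x - g x) \<le> ennreal (2 * K * (1 / 2) ^ k)"
      using dist by blast
    have "(\<lambda>k. 2 * K * (1 / 2) ^ k) \<longlonglongrightarrow> 2 * K * 0"
      by (intro tendsto_intros LIMSEQ_power_zero) simp
    then have "(\<lambda>k. ennreal (2 * K * (1 / 2) ^ k)) \<longlonglongrightarrow> 0"
      using tendsto_ennrealI by fastforce
    then show ?thesis
      by (rule tendsto_sandwich[rotated 2, OF tendsto_const]) (auto simp: K)
  qed
  ultimately show ?thesis using that lim by blast
qed

lemma tendsto_integral_mult_of_ball_L1:
  fixes f :: "nat \<Rightarrow> real^'n \<Rightarrow> real"
  assumes li: "\<And>k. locally_integrable (f k)" "locally_integrable F"
    and lim: "\<And>R. (\<lambda>k. ball_L1 R (\<lambda>x. f k x - F x)) \<longlonglongrightarrow> 0"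
    and h: "h \<in> borel_measurable lebesgue" "compact K" "\<And>x. x \<notin> K \<Longrightarrow> h x = 0" "\<And>x. \<bar>h x\<bar> \<le> M"
  shows "(\<lambda>k. LINT x|lebesgue. f k x * h x) \<longlonglongrightarrow> (LINT x|lebesgue. F x * h x)"
proof (rule tendsto_L1_int)
  note [measurable] = li[THEN locally_integrable_measurable] h(1)
  show "integrable lebesgue (\<lambda>x. f k x * h x)" "integrable lebesgue (\<lambda>x. F x * h x)" for k
    using h li by (auto intro!: integrable_locally_integrable_mult[of _ h K M])
  obtain R where R: "K \<subseteq> ball 0 R"
    using bounded_subset_ballD[OF compact_imp_bounded[OF h(2)]] by blast
  have M: "0 \<le> M" using h(4)[of 0] by linarith
  have bound: "(\<integral>\<^sup>+x. ennreal (norm (f k x * h x - F x * h x)) \<partial>lebesgue) \<le>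
      ennreal M * ball_L1 R (\<lambda>x. f k x - F x)" for k
  proof -
    have "norm (f k x * h x - F x * h x) \<le> M * (norm (f k x - F x) * indicator (ball 0 R) x)" for x
    proof (cases "x \<in> K")
      case True
      then have "x \<in> ball 0 R" using R by blast
      moreover have "norm (f k x * h x - F x * h x) = \<bar>f k x - F x\<bar> * \<bar>h x\<bar>"
        by (simp add: left_diff_distrib[symmetric] abs_mult)
      ultimately show ?thesis
        using mult_left_mono[OF h(4)[of x], of "\<bar>f k x - F x\<bar>"] by (simp add: mult.commute)
    qed (use h M in auto)
    then have "(\<integral>\<^sup>+x. ennreal (norm (f k x * h x - F x * h x)) \<partial>lebesgue) \<le>
        (\<integral>\<^sup>+x. ennreal (M * (norm (f k x - F x) * indicator (ball 0 R) x)) \<partial>lebesgue)"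
      by (intro nn_integral_mono ennreal_leI)
    also have "\<dots> = (\<integral>\<^sup>+x. ennreal M * (ennreal (norm (f k x - F x)) * indicator (ball 0 R) x) \<partial>lebesgue)"
      using M by (intro nn_integral_cong) (auto simp: indicator_def ennreal_mult')
    also have "\<dots> = ennreal M * ball_L1 R (\<lambda>x. f k x - F x)"
      unfolding ball_L1_def by (intro nn_integral_cmult) measurable
    finally show ?thesis .
  qed
  have "(\<lambda>k. ennreal M * ball_L1 R (\<lambda>x. f k x - F x)) \<longlonglongrightarrow> ennreal M * 0"
    by (intro ennreal_tendsto_cmult lim) simp
  then have "(\<lambda>k. ennreal M * ball_L1 R (\<lambda>x. f k x - F x)) \<longlonglongrightarrow> 0" by simp
  then show "(\<lambda>k. \<integral>\<^sup>+x. ennreal (norm (f k x * h x - F x * h x)) \<partial>lebesgue) \<longlonglongrightarrow> 0"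
    by (rule tendsto_sandwich[rotated 2, OF tendsto_const]) (use bound in simp_all)
qed

text \<open>A test function and its derivatives are bounded and live on a compact set, so both sides of the
integration by parts identity converge when functions and gradients converge locally in $L^1$.\<close>

lemma has_weak_gradient_limit:
  fixes f :: "nat \<Rightarrow> real^'n \<Rightarrow> real"
  assumes wg: "\<And>k. has_weak_gradient (f k) (g k)"
    and F: "locally_integrable F" "\<And>R. (\<lambda>k. ball_L1 R (\<lambda>x. f k x - F x)) \<longlonglongrightarrow> 0"
    and G: "locally_integrable G" "\<And>R. (\<lambda>k. ball_L1 R (\<lambda>x. g k x - G x)) \<longlonglongrightarrow> 0"
  shows "has_weak_gradient F G"
  unfolding has_weak_gradient_def
proof (intro conjI ballI allI F(1) G(1))
  fix \<phi> :: "real^'n \<Rightarrow> real" and i assume \<phi>: "\<phi> \<in> test_functions"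
  obtain K M where K: "compact K" "\<And>x. x \<notin> K \<Longrightarrow> \<phi> x = 0"
    "\<And>x i. x \<notin> K \<Longrightarrow> frechet_derivative \<phi> (at x) (axis i 1) = 0"
    "\<And>x. \<bar>\<phi> x\<bar> \<le> M" "\<And>x i. \<bar>frechet_derivative \<phi> (at x) (axis i 1)\<bar> \<le> M"
    "\<phi> \<in> borel_measurable lebesgue"
    "\<And>i. (\<lambda>x. frechet_derivative \<phi> (at x) (axis i 1)) \<in> borel_measurable lebesgue"
    by (metis test_function_bounds[OF \<phi>])
  have li: "\<And>k. locally_integrable (f k)" "\<And>k. locally_integrable (g k)"
    using wg by (auto simp: has_weak_gradient_def)
  have 1: "(\<lambda>k. LINT x|lebesgue. f k x * frechet_derivative \<phi> (at x) (axis i 1)) \<longlonglongrightarrow>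
      (LINT x|lebesgue. F x * frechet_derivative \<phi> (at x) (axis i 1))"
    by (rule tendsto_integral_mult_of_ball_L1[OF li(1) F K(7) K(1) K(3) K(5)])
  have "(\<lambda>k. ball_L1 R (\<lambda>x. g k x $ i - G x $ i)) \<longlonglongrightarrow> 0" for R
  proof (rule tendsto_sandwich[OF _ _ tendsto_const G(2)])
    have "ball_L1 R (\<lambda>x. g k x $ i - G x $ i) \<le> ball_L1 R (\<lambda>x. g k x - G x)" for k
      unfolding ball_L1_def using component_le_norm_cart[of "g k _ - G _" i]
      by (intro nn_integral_mono mult_right_mono ennreal_leI) auto
    then show "eventually (\<lambda>k. ball_L1 R (\<lambda>x. g k x $ i - G x $ i) \<le> ball_L1 R (\<lambda>x. g k x - G x)) sequentially"
      by simp
  qed simp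
  then have 2: "(\<lambda>k. LINT x|lebesgue. g k x $ i * \<phi> x) \<longlonglongrightarrow> (LINT x|lebesgue. G x $ i * \<phi> x)"
    using li(2) G(1)
    by (intro tendsto_integral_mult_of_ball_L1[OF _ _ _ K(6) K(1) K(2) K(4)] locally_integrable_componentwise)
  have "(LINT x|lebesgue. f k x * frechet_derivative \<phi> (at x) (axis i 1)) = - (LINT x|lebesgue. g k x $ i * \<phi> x)" for k
    using wg[of k] \<phi> unfolding has_weak_gradient_def by blast
  then show "(LINT x|lebesgue. F x * frechet_derivative \<phi> (at x) (axis i 1)) = - (LINT x|lebesgue. G x $ i * \<phi> x)"
    using LIMSEQ_unique[OF 1] tendsto_minus[OF 2] by simp
qed

section \<open>Convex homogeneous functionals and completeness in normed spaces\<close>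

text \<open>The set $\{E \le 1\}$ is convex and the $q$-th root of $E$ is its gauge. Let $A$ and $B$ exceed the roots of
$E(u)$ and $E(v)$. Then $u/A$ and $v/B$ lie in that set, and $(u + v)/(A + B)$ is a convex combination
of them.\<close>

lemma convex_homogeneous_root_subadditive:
  fixes E :: "'v::real_vector \<Rightarrow> ennreal"
  assumes S: "subspace S" and q: "0 < q"
    and hom: "\<And>c u. u \<in> S \<Longrightarrow> E (c *\<^sub>R u) = ennreal (\<bar>c\<bar> powr q) * E u"
    and conv: "\<And>u v s t. u \<in> S \<Longrightarrow> v \<in> S \<Longrightarrow> 0 \<le> s \<Longrightarrow> 0 \<le> t \<Longrightarrow> s + t = 1 \<Longrightarrow>
      E (s *\<^sub>R u + t *\<^sub>R v) \<le> ennreal s * E u + ennreal t * E v"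
    and uv: "u \<in> S" "v \<in> S" "E u < \<infinity>" "E v < \<infinity>"
  shows "E (u + v) < \<infinity>"
    and "enn2real (E (u + v)) powr (1 / q) \<le> enn2real (E u) powr (1 / q) + enn2real (E v) powr (1 / q)"
proof -
  define a where "a = enn2real (E u) powr (1 / q)"
  define b where "b = enn2real (E v) powr (1 / q)"
  have ab: "a \<ge> 0" "b \<ge> 0" by (auto simp: a_def b_def)
  have Eu: "E u = ennreal (a powr q)" and Ev: "E v = ennreal (b powr q)"
    using q uv by (auto simp: a_def b_def powr_powr)
  have unit: "E ((1 / A) *\<^sub>R w) \<le> 1"
    if "w \<in> S" "E w = ennreal (c powr q)" "0 \<le> c" "c < A" for A c w
  proof -
    have "E ((1 / A) *\<^sub>R w) = ennreal ((1 / A) powr q * c powr q)"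
      using that by (simp add: hom ennreal_mult)
    also have "\<dots> = ennreal ((c / A) powr q)"
      using that by (simp add: powr_mult[symmetric])
    also have "\<dots> \<le> ennreal 1"
      using that q by (intro ennreal_leI powr_le1) auto
    finally show ?thesis by simp
  qed
  have bound: "E (u + v) \<le> ennreal ((A + B) powr q)" if A: "a < A" and B: "b < B" for A B
  proof -
    let ?w = "(A / (A + B)) *\<^sub>R ((1 / A) *\<^sub>R u) + (B / (A + B)) *\<^sub>R ((1 / B) *\<^sub>R v)"
    have pos: "A > 0" "B > 0" using A B ab by auto
    have S': "(1 / A) *\<^sub>R u \<in> S" "(1 / B) *\<^sub>R v \<in> S" "?w \<in> S"
      using uv by (simp_all add: subspace_add[OF S] subspace_scale[OF S] del: scaleR_scaleR)
    have "E ?w \<le> ennreal (A / (A + B)) * E ((1 / A) *\<^sub>R u) + ennreal (B / (A + B)) * E ((1 / B) *\<^sub>R v)"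
      using S' pos by (intro conv) (auto simp: add_divide_distrib[symmetric])
    also have "\<dots> \<le> ennreal (A / (A + B)) * 1 + ennreal (B / (A + B)) * 1"
      using unit[OF uv(1) Eu _ A] unit[OF uv(2) Ev _ B] ab by (intro add_mono mult_left_mono) auto
    also have "\<dots> = ennreal (A / (A + B) + B / (A + B))"
      using pos by simp
    also have "A / (A + B) + B / (A + B) = 1"
      using pos by (simp add: add_divide_distrib[symmetric])
    finally have w: "E ?w \<le> 1" by simp
    have "u + v = (A + B) *\<^sub>R ?w"
      using pos by (simp add: scaleR_add_right)
    then have "E (u + v) = ennreal ((A + B) powr q) * E ?w"
      using hom[OF S'(3), of "A + B"] pos by simp
    also have "\<dots> \<le> ennreal ((A + B) powr q) * 1"
      using w by (rule mult_left_mono) simp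
    finally show ?thesis by simp
  qed
  show fin: "E (u + v) < \<infinity>"
    using bound[of "a + 1" "b + 1"] by (auto intro: order_le_less_trans)
  have "enn2real (E (u + v)) powr (1 / q) \<le> a + b + e" if "e > 0" for e
  proof -
    have "enn2real (E (u + v)) \<le> (a + b + e) powr q"
      using bound[of "a + e / 2" "b + e / 2"] that by (intro enn2real_leI) (auto simp: algebra_simps)
    then have "enn2real (E (u + v)) powr (1 / q) \<le> ((a + b + e) powr q) powr (1 / q)"
      using q by (intro powr_mono2) auto
    also have "\<dots> = a + b + e"
      using q ab that by (simp add: powr_powr)
    finally show ?thesis .
  qed
  then show "enn2real (E (u + v)) powr (1 / q) \<le> a + b"
    by (rule field_le_epsilon)
qed

text \<open>The locale of metric spaces asks for nonnegativity and symmetry of the distance on the whole type,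
not only on the carrier; hence the two global hypotheses.\<close>

lemma normed_space_on_Metric_space:
  assumes N: "normed_space_on S \<nu>" and nn: "\<And>u. 0 \<le> \<nu> u" and sym: "\<And>u. \<nu> (- u) = \<nu> u"
  shows "Metric_space S (\<lambda>u v. \<nu> (u - v))"
proof
  have S: "subspace S" using N by (simp add: normed_space_on_def)
  show "0 \<le> \<nu> (x - y)" for x y by (rule nn)
  show "\<nu> (x - y) = \<nu> (y - x)" for x y using sym[of "x - y"] by simp
  show "\<nu> (x - y) = 0 \<longleftrightarrow> x = y" if "x \<in> S" "y \<in> S" for x y
    using N subspace_diff[OF S that] by (auto simp: normed_space_on_def)
  show "\<nu> (x - z) \<le> \<nu> (x - y) + \<nu> (y - z)" if "x \<in> S" "y \<in> S" "z \<in> S" for x y z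
  proof -
    have "\<forall>u\<in>S. \<forall>v\<in>S. \<nu> (u + v) \<le> \<nu> u + \<nu> v"
      using N by (simp add: normed_space_on_def)
    from this[rule_format, OF subspace_diff[OF S that(1,2)] subspace_diff[OF S that(2,3)]]
    show ?thesis by simp
  qed
qed

text \<open>A Cauchy sequence converges as soon as one of its subsequences does, and the subsequence can be
chosen with geometrically small tails.\<close>

lemma complete_normed_space_onI:
  assumes N: "normed_space_on S \<nu>" and nn: "\<And>u. 0 \<le> \<nu> u" and sym: "\<And>u. \<nu> (- u) = \<nu> u"
    and fast: "\<And>\<sigma>. (\<And>k. \<sigma> k \<in> S) \<Longrightarrow> (\<And>j k. k \<le> j \<Longrightarrow> \<nu> (\<sigma> j - \<sigma> k) \<le> (1 / 2) ^ k) \<Longrightarrow>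
      \<exists>u\<in>S. (\<lambda>k. \<nu> (\<sigma> k - u)) \<longlonglongrightarrow> 0"
  shows "complete_normed_space_on S \<nu>"
proof -
  interpret Metric_space S "\<lambda>u v. \<nu> (u - v)"
    by (rule normed_space_on_Metric_space[OF N nn sym])
  have mcomplete
    unfolding mcomplete_def
  proof (intro allI impI)
    fix \<sigma> assume \<sigma>: "MCauchy \<sigma>"
    then have inS: "\<And>k. \<sigma> k \<in> S" by (auto simp: MCauchy_def)
    have "\<forall>k. \<exists>N. \<forall>n n'. N \<le> n \<longrightarrow> N \<le> n' \<longrightarrow> \<nu> (\<sigma> n - \<sigma> n') < (1 / 2) ^ k"
    proof
      fix k :: nat
      have "(0::real) < (1 / 2) ^ k" by simp
      then show "\<exists>N. \<forall>n n'. N \<le> n \<longrightarrow> N \<le> n' \<longrightarrow> \<nu> (\<sigma> n - \<sigma> n') < (1 / 2) ^ k"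
        using \<sigma> unfolding MCauchy_def by blast
    qed
    then obtain N where N: "\<And>k n n'. N k \<le> n \<Longrightarrow> N k \<le> n' \<Longrightarrow> \<nu> (\<sigma> n - \<sigma> n') < (1 / 2) ^ k"
      by metis
    have "\<exists>r. \<forall>k. N k \<le> r k \<and> r k < r (Suc k)"
    proof (rule dependent_nat_choice)
      show "\<exists>x. N 0 \<le> x" by blast
      show "\<exists>y. N (Suc n) \<le> y \<and> x < y" for x n
        by (rule exI[of _ "max (N (Suc n)) (Suc x)"]) auto
    qed
    then obtain r where r: "\<And>k. N k \<le> r k" "strict_mono r"
      by (auto simp: strict_mono_Suc_iff)
    have "\<nu> ((\<sigma> \<circ> r) j - (\<sigma> \<circ> r) k) \<le> (1 / 2) ^ k" if "k \<le> j" for j k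
    proof -
      have "r k \<le> r j" using r(2) that by (simp add: strict_mono_less_eq)
      then show ?thesis using N[of k "r j" "r k"] r(1)[of k] by (simp add: order_trans less_imp_le)
    qed
    then obtain u where u: "u \<in> S" "(\<lambda>k. \<nu> ((\<sigma> \<circ> r) k - u)) \<longlonglongrightarrow> 0"
      using fast[of "\<sigma> \<circ> r"] inS by auto
    have "limitin mtopology (\<sigma> \<circ> r) u sequentially"
      using u inS nn unfolding limit_metric_sequentially LIMSEQ_iff by auto
    then show "\<exists>x. limitin mtopology \<sigma> x sequentially"
      using MCauchy_convergent_subsequence[OF \<sigma> r(2)] by blast
  qed
  then show ?thesis using N by (simp add: complete_normed_space_on_def)
qed

section \<open>Energies of classes of functions\<close>

lift_definition ae_coulomb_energy :: "real \<Rightarrow> real \<Rightarrow> 'n::finite ae_fun \<Rightarrow> ennreal" is coulomb_energy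
  by (rule coulomb_energy_cong_AE)

lift_definition ae_dirichlet_energy :: "'n::finite ae_fun \<Rightarrow> ennreal" is dirichlet_energy
  by (rule dirichlet_energy_cong_AE)

lift_definition ae_weakly_differentiable :: "'n::finite ae_fun \<Rightarrow> bool" is weakly_differentiable
  by (simp add: weakly_differentiable_def has_weak_gradient_cong_AE)

lemma coulomb_sobolev_space_iff:
  "u \<in> coulomb_sobolev_space \<alpha> p \<longleftrightarrow>
    ae_coulomb_energy \<alpha> p u < \<infinity> \<and> ae_weakly_differentiable u \<and> ae_dirichlet_energy u < \<infinity>"
  unfolding coulomb_sobolev_space_def mem_Collect_eq by transfer simp

lemma coulomb_sobolev_norm_eq:
  "coulomb_sobolev_norm \<alpha> p u =
    sqrt (enn2real (ae_dirichlet_energy u) + enn2real (ae_coulomb_energy \<alpha> p u) powr (1 / p))"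
  by transfer simp

lemma ae_fun_cases:
  obtains f where "f \<in> borel_measurable lebesgue" "u = abs_ae_fun f"
proof
  have "ae_rel (rep_ae_fun u) (rep_ae_fun u)"
    by (rule Quotient3_rep_reflp[OF Quotient3_ae_fun])
  then show "rep_ae_fun u \<in> borel_measurable lebesgue" by (simp add: ae_rel_def)
  show "u = abs_ae_fun (rep_ae_fun u)"
    by (rule Quotient3_abs_rep[OF Quotient3_ae_fun, symmetric])
qed

lemma ae_rel_refl: "f \<in> borel_measurable lebesgue \<Longrightarrow> ae_rel f f"
  by (simp add: ae_rel_def)

lemma ae_energy_abs:
  assumes "f \<in> borel_measurable lebesgue"
  shows "ae_coulomb_energy \<alpha> p (abs_ae_fun f) = coulomb_energy \<alpha> p f"
    and "ae_dirichlet_energy (abs_ae_fun f) = dirichlet_energy f"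
    and "ae_weakly_differentiable (abs_ae_fun f) = weakly_differentiable f"
  using assms by (auto intro!: ae_coulomb_energy.abs_eq ae_dirichlet_energy.abs_eq
      ae_weakly_differentiable.abs_eq ae_rel_refl)

text \<open>The weak gradient of the combination is the combination of the weak gradients, by linearity and
uniqueness; the rest is convexity of the squared norm.\<close>

lemma dirichlet_energy_convex:
  fixes f g :: "real^'n \<Rightarrow> real"
  assumes wd: "weakly_differentiable f" "weakly_differentiable g"
    and st: "0 \<le> s" "0 \<le> t" "s + t = 1"
  shows "dirichlet_energy (\<lambda>x. s * f x + t * g x) \<le>
    ennreal s * dirichlet_energy f + ennreal t * dirichlet_energy g"
proof -
  let ?F = "weak_gradient f" and ?G = "weak_gradient g"
  note wg = wd[THEN has_weak_gradient_weak_gradient]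
  have [measurable]: "?F \<in> borel_measurable lebesgue" "?G \<in> borel_measurable lebesgue"
    using wg by (auto simp: has_weak_gradient_def intro: locally_integrable_measurable)
  have "dirichlet_energy (\<lambda>x. s * f x + t * g x) =
      (\<integral>\<^sup>+x. ennreal ((norm (s *\<^sub>R ?F x + t *\<^sub>R ?G x))\<^sup>2) \<partial>lebesgue)"
    by (intro dirichlet_energy_eq has_weak_gradient_add has_weak_gradient_scaleR wg)
  also have "\<dots> \<le> (\<integral>\<^sup>+x. (ennreal s * ennreal ((norm (?F x))\<^sup>2) + ennreal t * ennreal ((norm (?G x))\<^sup>2)) \<partial>lebesgue)"
  proof (rule nn_integral_mono)
    fix x
    have "norm (s *\<^sub>R ?F x + t *\<^sub>R ?G x) \<le> s * norm (?F x) + t * norm (?G x)"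
      using norm_triangle_ineq[of "s *\<^sub>R ?F x" "t *\<^sub>R ?G x"] st by simp
    then have "ennreal ((norm (s *\<^sub>R ?F x + t *\<^sub>R ?G x))\<^sup>2) \<le>
        (ennreal s * ennreal (norm (?F x)) + ennreal t * ennreal (norm (?G x)))\<^sup>2"
      using st by (simp add: ennreal_mult'[symmetric] ennreal_plus[symmetric] ennreal_power ennreal_leI power_mono
          del: ennreal_plus)
    also have "\<dots> \<le> ennreal s * (ennreal (norm (?F x)))\<^sup>2 + ennreal t * (ennreal (norm (?G x)))\<^sup>2"
      by (rule ennreal_square_convex[OF st])
    finally show "ennreal ((norm (s *\<^sub>R ?F x + t *\<^sub>R ?G x))\<^sup>2) \<le>
        ennreal s * ennreal ((norm (?F x))\<^sup>2) + ennreal t * ennreal ((norm (?G x))\<^sup>2)"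
      by (simp add: ennreal_power)
  qed
  also have "\<dots> = ennreal s * dirichlet_energy f + ennreal t * dirichlet_energy g"
    unfolding dirichlet_energy_def by (subst nn_integral_add) (auto simp: nn_integral_cmult)
  finally show ?thesis .
qed

lemma dirichlet_energy_scale:
  fixes f :: "real^'n \<Rightarrow> real"
  assumes "weakly_differentiable f"
  shows "dirichlet_energy (\<lambda>x. c * f x) = ennreal (\<bar>c\<bar> powr 2) * dirichlet_energy f"
proof -
  note wg = has_weak_gradient_weak_gradient[OF assms]
  have [measurable]: "weak_gradient f \<in> borel_measurable lebesgue"
    using wg by (auto simp: has_weak_gradient_def intro: locally_integrable_measurable)
  have "dirichlet_energy (\<lambda>x. c * f x) =
      (\<integral>\<^sup>+x. ennreal ((norm (c *\<^sub>R weak_gradient f x))\<^sup>2) \<partial>lebesgue)"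
    by (intro dirichlet_energy_eq has_weak_gradient_scaleR wg)
  also have "\<dots> = (\<integral>\<^sup>+x. ennreal (\<bar>c\<bar> powr 2) * ennreal ((norm (weak_gradient f x))\<^sup>2) \<partial>lebesgue)"
    by (intro nn_integral_cong) (simp add: power_mult_distrib ennreal_mult'[symmetric])
  also have "\<dots> = ennreal (\<bar>c\<bar> powr 2) * dirichlet_energy f"
    unfolding dirichlet_energy_def by (intro nn_integral_cmult) measurable
  finally show ?thesis .
qed

lemma subspace_ae_weakly_differentiable: "subspace {u. ae_weakly_differentiable u}"
  unfolding subspace_def mem_Collect_eq
proof (intro conjI ballI allI)
  show "ae_weakly_differentiable 0"
    by transfer (use has_weak_gradient_0 in \<open>auto simp: weakly_differentiable_def\<close>)
  have *: "ae_weakly_differentiable u \<Longrightarrow> ae_weakly_differentiable v \<Longrightarrow> ae_weakly_differentiable (u + v)"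
    for u v :: "'a ae_fun"
    by transfer (auto simp: weakly_differentiable_def intro: has_weak_gradient_add)
  show "ae_weakly_differentiable (u + v)"
    if "u \<in> {u. ae_weakly_differentiable u}" "v \<in> {u. ae_weakly_differentiable u}" for u v :: "'a ae_fun"
    using * that by simp
  have "ae_weakly_differentiable u \<Longrightarrow> ae_weakly_differentiable (c *\<^sub>R u)" for c and u :: "'a ae_fun"
    by transfer (auto simp: weakly_differentiable_def intro: has_weak_gradient_scaleR)
  then show "ae_weakly_differentiable (c *\<^sub>R u)"
    if "u \<in> {u. ae_weakly_differentiable u}" for c and u :: "'a ae_fun"
    using that by simp
qed

lemma ae_dirichlet_energy_convex:
  assumes "ae_weakly_differentiable u" "ae_weakly_differentiable v" "0 \<le> s" "0 \<le> t" "s + t = 1"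
  shows "ae_dirichlet_energy (s *\<^sub>R u + t *\<^sub>R v) \<le> ennreal s * ae_dirichlet_energy u + ennreal t * ae_dirichlet_energy v"
  using assms by transfer (rule dirichlet_energy_convex)

lemma ae_dirichlet_energy_scale:
  assumes "ae_weakly_differentiable u"
  shows "ae_dirichlet_energy (c *\<^sub>R u) = ennreal (\<bar>c\<bar> powr 2) * ae_dirichlet_energy u"
  using assms by transfer (rule dirichlet_energy_scale)

lemma ae_coulomb_energy_convex:
  fixes u v :: "'n::finite ae_fun"
  assumes "0 < \<alpha>" "\<alpha> < real CARD('n)" "1 \<le> p" "0 \<le> s" "0 \<le> t" "s + t = 1"
  shows "ae_coulomb_energy \<alpha> p (s *\<^sub>R u + t *\<^sub>R v) \<le>
    ennreal s * ae_coulomb_energy \<alpha> p u + ennreal t * ae_coulomb_energy \<alpha> p v"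
  using assms by transfer (auto simp: ae_rel_def intro: coulomb_energy_convex)

lemma ae_coulomb_energy_scale:
  fixes u :: "'n::finite ae_fun"
  assumes "0 < \<alpha>" "\<alpha> < real CARD('n)"
  shows "ae_coulomb_energy \<alpha> p (c *\<^sub>R u) = ennreal (\<bar>c\<bar> powr (2 * p)) * ae_coulomb_energy \<alpha> p u"
  using assms by transfer (auto simp: ae_rel_def intro: coulomb_energy_scale)

section \<open>The Coulomb--Sobolev norm\<close>

text \<open>Energy $0$ is below every bound, so the local control makes the $L^1$ norm on each ball
arbitrarily small.\<close>

lemma coulomb_energy_0_imp_AE_0:
  fixes f :: "real^'n \<Rightarrow> real"
  assumes \<alpha>: "0 < \<alpha>" "\<alpha> < real CARD('n)" and p: "1 \<le> p"
    and m[measurable]: "f \<in> borel_measurable lebesgue" and 0: "coulomb_energy \<alpha> p f = 0"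
  shows "AE x in lebesgue. f x = 0"
proof -
  have "AE x in lebesgue. ennreal (norm (f x)) * indicator (ball 0 (real (Suc n))) x = 0" for n
  proof -
    have "0 < real (Suc n)" by simp
    then obtain K where K: "0 \<le> K" "\<And>(f :: real^'n \<Rightarrow> real) t. f \<in> borel_measurable lebesgue \<Longrightarrow> 0 < t \<Longrightarrow>
      coulomb_energy \<alpha> p f \<le> ennreal (t powr (2 * p)) \<Longrightarrow> ball_L1 (real (Suc n)) f \<le> ennreal (t * K)"
      by (rule coulomb_energy_controls_ball_L1[OF \<alpha> p]) blast
    \<comment> \<open>The scale \<open>e / (K + 1)\<close> is positive even if \<open>K = 0\<close>, and \<open>K\<close> times it is at most \<open>e\<close>.\<close>
    have "ball_L1 (real (Suc n)) f \<le> ennreal e" if "0 < e" for e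
    proof -
      have "ball_L1 (real (Suc n)) f \<le> ennreal (e / (K + 1) * K)"
        using K(1) that by (intro K(2) m) (auto simp: 0)
      also have "\<dots> \<le> ennreal e"
        using K(1) that by (intro ennreal_leI) (simp add: field_simps)
      finally show ?thesis .
    qed
    then have "ball_L1 (real (Suc n)) f = 0"
      using ennreal_le_epsilon[of 0 "ball_L1 (real (Suc n)) f"] by simp
    then show ?thesis
      unfolding ball_L1_def by (subst (asm) nn_integral_0_iff_AE) auto
  qed
  then have "AE x in lebesgue. \<forall>n. ennreal (norm (f x)) * indicator (ball 0 (real (Suc n))) x = 0"
    unfolding AE_all_countable by blast
  then show ?thesis
  proof eventually_elim
    case (elim x)
    obtain n where "norm x < real n" using reals_Archimedean2 by blast
    then have "x \<in> ball 0 (real (Suc n))" by simp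
    then show ?case using elim[rule_format, of n] by simp
  qed
qed

lemma ae_coulomb_energy_eq_0:
  fixes u :: "'n::finite ae_fun"
  assumes "0 < \<alpha>" "\<alpha> < real CARD('n)" "1 \<le> p" "ae_coulomb_energy \<alpha> p u = 0"
  shows "u = 0"
  using assms by transfer (auto simp: ae_rel_def intro: coulomb_energy_0_imp_AE_0)

text \<open>The norm is the Euclidean norm of the pair of seminorms $D^{1/2}$ and $E^{1/(2p)}$.\<close>

lemma coulomb_sobolev_norm_triangle:
  fixes u v :: "'n::finite ae_fun"
  assumes \<alpha>: "0 < \<alpha>" "\<alpha> < real CARD('n)" and p: "1 \<le> p"
    and uv: "u \<in> coulomb_sobolev_space \<alpha> p" "v \<in> coulomb_sobolev_space \<alpha> p"
  shows "u + v \<in> coulomb_sobolev_space \<alpha> p"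
    and "coulomb_sobolev_norm \<alpha> p (u + v) \<le> coulomb_sobolev_norm \<alpha> p u + coulomb_sobolev_norm \<alpha> p v"
proof -
  let ?D = "\<lambda>u :: 'n ae_fun. enn2real (ae_dirichlet_energy u) powr (1 / 2)"
  let ?E = "\<lambda>u :: 'n ae_fun. enn2real (ae_coulomb_energy \<alpha> p u) powr (1 / (2 * p))"
  have wd: "ae_weakly_differentiable u" "ae_weakly_differentiable v"
    and fin: "ae_dirichlet_energy u < \<infinity>" "ae_dirichlet_energy v < \<infinity>"
      "ae_coulomb_energy \<alpha> p u < \<infinity>" "ae_coulomb_energy \<alpha> p v < \<infinity>"
    using uv by (auto simp: coulomb_sobolev_space_iff)
  have D: "ae_dirichlet_energy (u + v) < \<infinity>" "?D (u + v) \<le> ?D u + ?D v"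
    using wd fin convex_homogeneous_root_subadditive[OF subspace_ae_weakly_differentiable, of 2 ae_dirichlet_energy u v]
    by (auto simp: ae_dirichlet_energy_scale ae_dirichlet_energy_convex)
  have E: "ae_coulomb_energy \<alpha> p (u + v) < \<infinity>" "?E (u + v) \<le> ?E u + ?E v"
    using fin p convex_homogeneous_root_subadditive[OF subspace_UNIV, of "2 * p" "ae_coulomb_energy \<alpha> p" u v]
    by (auto simp: ae_coulomb_energy_scale[OF \<alpha>] ae_coulomb_energy_convex[OF \<alpha> p])
  have "ae_weakly_differentiable (u + v)"
    using subspace_add[OF subspace_ae_weakly_differentiable, of u v] wd by simp
  then show "u + v \<in> coulomb_sobolev_space \<alpha> p"
    using D E by (simp add: coulomb_sobolev_space_iff)
  have norm: "coulomb_sobolev_norm \<alpha> p w = sqrt ((?D w)\<^sup>2 + (?E w)\<^sup>2)" for w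
    unfolding coulomb_sobolev_norm_eq
    by (simp add: power2_eq_square powr_add[symmetric] field_simps)
  have "sqrt ((?D (u + v))\<^sup>2 + (?E (u + v))\<^sup>2) \<le> sqrt ((?D u + ?D v)\<^sup>2 + (?E u + ?E v)\<^sup>2)"
    using D E by (intro real_sqrt_le_mono add_mono power_mono) auto
  also have "\<dots> \<le> sqrt ((?D u)\<^sup>2 + (?E u)\<^sup>2) + sqrt ((?D v)\<^sup>2 + (?E v)\<^sup>2)"
    by (rule real_sqrt_sum_squares_triangle_ineq)
  finally show "coulomb_sobolev_norm \<alpha> p (u + v) \<le> coulomb_sobolev_norm \<alpha> p u + coulomb_sobolev_norm \<alpha> p v"
    unfolding norm .
qed

lemma coulomb_sobolev_norm_scale:
  fixes u :: "'n::finite ae_fun"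
  assumes \<alpha>: "0 < \<alpha>" "\<alpha> < real CARD('n)" and p: "1 \<le> p"
    and u: "u \<in> coulomb_sobolev_space \<alpha> p"
  shows "c *\<^sub>R u \<in> coulomb_sobolev_space \<alpha> p"
    and "coulomb_sobolev_norm \<alpha> p (c *\<^sub>R u) = \<bar>c\<bar> * coulomb_sobolev_norm \<alpha> p u"
proof -
  have wd: "ae_weakly_differentiable u" using u by (simp add: coulomb_sobolev_space_iff)
  have E: "ae_coulomb_energy \<alpha> p (c *\<^sub>R u) = ennreal (\<bar>c\<bar> powr (2 * p)) * ae_coulomb_energy \<alpha> p u"
    by (rule ae_coulomb_energy_scale[OF \<alpha>])
  note D = ae_dirichlet_energy_scale[OF wd, of c]
  show "c *\<^sub>R u \<in> coulomb_sobolev_space \<alpha> p"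
    using u subspace_scale[OF subspace_ae_weakly_differentiable, of u c]
    by (auto simp: coulomb_sobolev_space_iff D E ennreal_mult_less_top)
  have "(\<bar>c\<bar> powr (2 * p) * e) powr (1 / p) = c\<^sup>2 * e powr (1 / p)" if "0 \<le> e" for e
    using that p by (simp add: powr_mult powr_powr)
  then have "coulomb_sobolev_norm \<alpha> p (c *\<^sub>R u) =
      sqrt (c\<^sup>2 * (enn2real (ae_dirichlet_energy u) + enn2real (ae_coulomb_energy \<alpha> p u) powr (1 / p)))"
    unfolding coulomb_sobolev_norm_eq by (simp add: D E enn2real_mult distrib_left)
  then show "coulomb_sobolev_norm \<alpha> p (c *\<^sub>R u) = \<bar>c\<bar> * coulomb_sobolev_norm \<alpha> p u"
    unfolding coulomb_sobolev_norm_eq by (simp add: real_sqrt_mult)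
qed

lemma zero_in_coulomb_sobolev_space:
  assumes \<alpha>: "0 < \<alpha>" "\<alpha> < real CARD('n)" and p: "1 \<le> p"
  shows "(0 :: 'n::finite ae_fun) \<in> coulomb_sobolev_space \<alpha> p"
proof -
  have wd: "ae_weakly_differentiable (0 :: 'n ae_fun)"
    using subspace_0[OF subspace_ae_weakly_differentiable] by simp
  show ?thesis
    using wd ae_dirichlet_energy_scale[OF wd, of 0] ae_coulomb_energy_scale[OF \<alpha>, of p 0 "0 :: 'n ae_fun"]
    by (simp add: coulomb_sobolev_space_iff)
qed

lemma coulomb_sobolev_normed_space:
  assumes \<alpha>: "0 < \<alpha>" "\<alpha> < real CARD('n::finite)" and p: "1 \<le> p"
  shows "normed_space_on (coulomb_sobolev_space \<alpha> p :: 'n ae_fun set) (coulomb_sobolev_norm \<alpha> p)"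
  unfolding normed_space_on_def
proof (intro conjI ballI allI)
  let ?S = "coulomb_sobolev_space \<alpha> p :: 'n ae_fun set"
  show "subspace ?S"
    unfolding subspace_def
    using zero_in_coulomb_sobolev_space[OF assms] coulomb_sobolev_norm_triangle(1)[OF assms]
      coulomb_sobolev_norm_scale(1)[OF assms] by blast
  fix u assume u: "u \<in> ?S"
  show "0 \<le> coulomb_sobolev_norm \<alpha> p u"
    by (simp add: coulomb_sobolev_norm_eq)
  show "coulomb_sobolev_norm \<alpha> p u = 0 \<longleftrightarrow> u = 0"
  proof
    assume "coulomb_sobolev_norm \<alpha> p u = 0"
    then have "enn2real (ae_dirichlet_energy u) + enn2real (ae_coulomb_energy \<alpha> p u) powr (1 / p) = 0"
      by (simp add: coulomb_sobolev_norm_eq)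
    then have "enn2real (ae_coulomb_energy \<alpha> p u) powr (1 / p) = 0"
      using enn2real_nonneg[of "ae_dirichlet_energy u"] powr_ge_zero[of "enn2real (ae_coulomb_energy \<alpha> p u)" "1 / p"]
      by linarith
    then have "ae_coulomb_energy \<alpha> p u = 0"
      using u by (auto simp: enn2real_eq_0_iff coulomb_sobolev_space_iff)
    then show "u = 0" by (rule ae_coulomb_energy_eq_0[OF assms])
  next
    assume "u = 0"
    then show "coulomb_sobolev_norm \<alpha> p u = 0"
      using coulomb_sobolev_norm_scale(2)[OF assms u, of 0] by simp
  qed
  show "coulomb_sobolev_norm \<alpha> p (c *\<^sub>R u) = \<bar>c\<bar> * coulomb_sobolev_norm \<alpha> p u" for c
    by (rule coulomb_sobolev_norm_scale(2)[OF assms u])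
  show "coulomb_sobolev_norm \<alpha> p (u + v) \<le> coulomb_sobolev_norm \<alpha> p u + coulomb_sobolev_norm \<alpha> p v"
    if "v \<in> ?S" for v
    by (rule coulomb_sobolev_norm_triangle(2)[OF assms u that])
qed

text \<open>This holds on the whole type, as the metric requires. If \<open>u\<close> is not weakly differentiable, then neither is
\<open>- u\<close>, and the unspecified gradient is the same choice from an empty set for both.\<close>

lemma coulomb_sobolev_norm_uminus:
  fixes u :: "'n::finite ae_fun"
  assumes \<alpha>: "0 < \<alpha>" "\<alpha> < real CARD('n)"
  shows "coulomb_sobolev_norm \<alpha> p (- u) = coulomb_sobolev_norm \<alpha> p u"
proof -
  have "ae_dirichlet_energy (- u) = ae_dirichlet_energy u"
  proof (cases "ae_weakly_differentiable u")
    case True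
    then show ?thesis using ae_dirichlet_energy_scale[OF True, of "-1"] by simp
  next
    case False
    then have "\<not> ae_weakly_differentiable (- u)"
      using subspace_neg[OF subspace_ae_weakly_differentiable, of "- u"] by auto
    moreover have "ae_dirichlet_energy v = ae_dirichlet_energy w"
      if "\<not> ae_weakly_differentiable v" "\<not> ae_weakly_differentiable w" for v w :: "'n ae_fun"
      using that by transfer (simp add: dirichlet_energy_def weak_gradient_def weakly_differentiable_def)
    ultimately show ?thesis using False by blast
  qed
  moreover have "ae_coulomb_energy \<alpha> p (- u) = ae_coulomb_energy \<alpha> p u"
    using ae_coulomb_energy_scale[OF \<alpha>, of p "-1" u] by simp
  ultimately show ?thesis by (simp add: coulomb_sobolev_norm_eq)
qed

text \<open>Bounds by $t^2$ and $t^{2p}$ are the form in which both energies scale like a norm; this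
lemma and the next one pass between such bounds and the norm, up to the factor $2$.\<close>

lemma energies_le_of_norm_le:
  assumes u: "u \<in> coulomb_sobolev_space \<alpha> p" and p: "1 \<le> p" and t: "0 < t"
    and le: "coulomb_sobolev_norm \<alpha> p u \<le> t"
  shows "ae_dirichlet_energy u \<le> ennreal (t\<^sup>2)"
    and "ae_coulomb_energy \<alpha> p u \<le> ennreal (t powr (2 * p))"
proof -
  let ?d = "enn2real (ae_dirichlet_energy u)" and ?e = "enn2real (ae_coulomb_energy \<alpha> p u)"
  have d: "ae_dirichlet_energy u = ennreal ?d" and e: "ae_coulomb_energy \<alpha> p u = ennreal ?e"
    using u by (auto simp: coulomb_sobolev_space_iff)
  have "?d + ?e powr (1 / p) \<le> t\<^sup>2"
    using le t unfolding coulomb_sobolev_norm_eq by (simp add: real_sqrt_le_iff' real_le_lsqrt sqrt_le_D)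
  then have d': "?d \<le> t\<^sup>2" and e': "?e powr (1 / p) \<le> t\<^sup>2"
    using enn2real_nonneg[of "ae_dirichlet_energy u"] powr_ge_zero[of ?e "1 / p"] by linarith+
  have "?e = (?e powr (1 / p)) powr p" using p by (simp add: powr_powr)
  also have "\<dots> \<le> (t\<^sup>2) powr p" using e' p by (intro powr_mono2) auto
  also have "\<dots> = t powr (2 * p)" using t by (simp add: powr_powr[symmetric])
  finally have e'': "?e \<le> t powr (2 * p)" .
  show "ae_dirichlet_energy u \<le> ennreal (t\<^sup>2)" by (subst d) (rule ennreal_leI[OF d'])
  show "ae_coulomb_energy \<alpha> p u \<le> ennreal (t powr (2 * p))" by (subst e) (rule ennreal_leI[OF e''])
qed

lemma norm_le_of_energies_le:
  assumes p: "1 \<le> p" and t: "0 < t"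
    and D: "ae_dirichlet_energy u \<le> ennreal (t\<^sup>2)"
    and E: "ae_coulomb_energy \<alpha> p u \<le> ennreal (t powr (2 * p))"
  shows "coulomb_sobolev_norm \<alpha> p u \<le> 2 * t"
proof -
  let ?d = "enn2real (ae_dirichlet_energy u)" and ?e = "enn2real (ae_coulomb_energy \<alpha> p u)"
  have d: "?d \<le> t\<^sup>2" using D by (intro enn2real_leI) auto
  have "?e \<le> t powr (2 * p)" using E by (intro enn2real_leI) auto
  then have "?e powr (1 / p) \<le> (t powr (2 * p)) powr (1 / p)"
    using p by (intro powr_mono2) auto
  also have "\<dots> = t\<^sup>2" using t p by (simp add: powr_powr)
  finally have "?e powr (1 / p) \<le> t\<^sup>2" .
  moreover have four: "(2 * t)\<^sup>2 = 4 * t\<^sup>2" by (simp add: power_mult_distrib)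
  ultimately have "?d + ?e powr (1 / p) \<le> (2 * t)\<^sup>2"
    using d zero_le_power2[of t] unfolding four by linarith
  then show ?thesis
    unfolding coulomb_sobolev_norm_eq using t by (intro real_le_lsqrt) auto
qed

section \<open>Completeness\<close>

text \<open>The energy bounds give convergence of functions and weak gradients, locally in $L^1$ and almost
everywhere. The first identifies the gradient of the limit, the second gives the bounds for the limit
by lower semicontinuity in \<open>j\<close>.\<close>

lemma fast_Cauchy_energy_limit:
  fixes f :: "nat \<Rightarrow> real^'n \<Rightarrow> real"
  assumes \<alpha>: "0 < \<alpha>" "\<alpha> < real CARD('n)" and p: "1 \<le> p"
    and wd: "\<And>k. weakly_differentiable (f k)"
    and D: "\<And>j k. k \<le> j \<Longrightarrow> dirichlet_energy (\<lambda>x. f j x - f k x) \<le> ennreal (((1 / 2) ^ k)\<^sup>2)"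
    and E: "\<And>j k. k \<le> j \<Longrightarrow> coulomb_energy \<alpha> p (\<lambda>x. f j x - f k x) \<le> ennreal (((1 / 2) ^ k) powr (2 * p))"
  shows "\<exists>F. weakly_differentiable F \<and> (\<forall>k.
    dirichlet_energy (\<lambda>x. F x - f k x) \<le> ennreal (((1 / 2) ^ k)\<^sup>2) \<and>
    coulomb_energy \<alpha> p (\<lambda>x. F x - f k x) \<le> ennreal (((1 / 2) ^ k) powr (2 * p)))"
proof -
  define g where "g k = weak_gradient (f k)" for k
  have wg: "has_weak_gradient (f k) (g k)" for k
    unfolding g_def by (rule has_weak_gradient_weak_gradient[OF wd])
  then have lif: "locally_integrable (f k)" and lig: "locally_integrable (g k)" for k
    by (auto simp: has_weak_gradient_def)
  note [measurable] = lif[THEN locally_integrable_measurable] lig[THEN locally_integrable_measurable]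
  have wg_diff: "has_weak_gradient (\<lambda>x. u x - v x) (\<lambda>x. u' x - v' x)"
    if "has_weak_gradient u u'" "has_weak_gradient v v'" for u v :: "real^'n \<Rightarrow> real" and u' v'
    using has_weak_gradient_add[OF that(1) has_weak_gradient_scaleR[OF that(2), of "-1"]] by simp
  have Dg: "(\<integral>\<^sup>+x. ennreal ((norm (g j x - g k x))\<^sup>2) \<partial>lebesgue) \<le> ennreal (((1 / 2) ^ k)\<^sup>2)" if "k \<le> j" for j k
    using D[OF that] unfolding dirichlet_energy_eq[OF wg_diff[OF wg wg]] .
  have fastf: "\<exists>K. \<forall>k. ball_L1 R (\<lambda>x. f (Suc k) x - f k x) \<le> ennreal (K * (1 / 2) ^ k)" for R
  proof (cases "R > 0")
    case True
    then obtain K where K: "0 \<le> K" "\<And>(f :: real^'n \<Rightarrow> real) t. f \<in> borel_measurable lebesgue \<Longrightarrow> 0 < t \<Longrightarrow>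
      coulomb_energy \<alpha> p f \<le> ennreal (t powr (2 * p)) \<Longrightarrow> ball_L1 R f \<le> ennreal (t * K)"
      by (rule coulomb_energy_controls_ball_L1[OF \<alpha> p]) blast
    have "ball_L1 R (\<lambda>x. f (Suc k) x - f k x) \<le> ennreal ((1 / 2) ^ k * K)" for k
      by (rule K(2)) (use E[of k "Suc k"] in auto)
    then show ?thesis by (auto simp: mult.commute)
  next
    case False
    then have empty: "ball (0::real^'n) R = {}" by simp
    show ?thesis by (intro exI[of _ 0]) (simp add: ball_L1_def empty)
  qed
  have fastg: "\<exists>K. \<forall>k. ball_L1 R (\<lambda>x. g (Suc k) x - g k x) \<le> ennreal (K * (1 / 2) ^ k)" for R
  proof -
    define v where "v = measure lborel (ball (0::real^'n) R)"
    have v: "emeasure lebesgue (ball (0::real^'n) R) = ennreal v"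
      using emeasure_lborel_ball_finite[of "0::real^'n" R]
      by (auto simp: v_def emeasure_eq_ennreal_measure)
    have "ball_L1 R (\<lambda>x. g (Suc k) x - g k x) \<le> ennreal ((v + 1) * (1 / 2) ^ k)" for k
    proof -
      have "ball_L1 R (\<lambda>x. g (Suc k) x - g k x) \<le> ennreal ((1 / 2) ^ k) * (emeasure lebesgue (ball (0::real^'n) R) + 1)"
        by (rule square_integral_controls_ball_L1) (use Dg[of k "Suc k"] in auto)
      also have "\<dots> = ennreal ((1 / 2) ^ k) * ennreal (v + 1)"
        unfolding v by (simp add: v_def)
      also have "\<dots> = ennreal ((v + 1) * (1 / 2) ^ k)"
        by (simp add: ennreal_mult''[symmetric] mult.commute)
      finally show ?thesis .
    qed
    then show ?thesis by blast
  qed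
  obtain F where F: "locally_integrable F" "AE x in lebesgue. (\<lambda>k. f k x) \<longlonglongrightarrow> F x"
    "\<And>R. (\<lambda>k. ball_L1 R (\<lambda>x. f k x - F x)) \<longlonglongrightarrow> 0"
    by (rule fast_local_Cauchy_limit[OF lif fastf]) blast
  obtain G where G: "locally_integrable G" "AE x in lebesgue. (\<lambda>k. g k x) \<longlonglongrightarrow> G x"
    "\<And>R. (\<lambda>k. ball_L1 R (\<lambda>x. g k x - G x)) \<longlonglongrightarrow> 0"
    by (rule fast_local_Cauchy_limit[OF lig fastg]) blast
  have FG: "has_weak_gradient F G"
    by (rule has_weak_gradient_limit[OF wg F(1,3) G(1,3)])
  show ?thesis
  proof (intro exI[of _ F] conjI allI)
    show "weakly_differentiable F" using FG by (auto simp: weakly_differentiable_def)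
    fix k
    have "(\<integral>\<^sup>+x. ennreal ((norm (G x - g k x))\<^sup>2) \<partial>lebesgue) \<le> ennreal (((1 / 2) ^ k)\<^sup>2)"
    proof (rule nn_integral_le_of_AE_tendsto)
      show "AE x in lebesgue. (\<lambda>j. ennreal ((norm (g j x - g k x))\<^sup>2)) \<longlonglongrightarrow> ennreal ((norm (G x - g k x))\<^sup>2)"
        using G(2) by eventually_elim (intro tendsto_ennrealI tendsto_power tendsto_norm tendsto_diff tendsto_const)
      show "eventually (\<lambda>j. (\<integral>\<^sup>+x. ennreal ((norm (g j x - g k x))\<^sup>2) \<partial>lebesgue) \<le> ennreal (((1 / 2) ^ k)\<^sup>2)) sequentially"
        using eventually_ge_at_top[of k] by (rule eventually_mono) (rule Dg)
    qed measurable
    then show "dirichlet_energy (\<lambda>x. F x - f k x) \<le> ennreal (((1 / 2) ^ k)\<^sup>2)"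
      unfolding dirichlet_energy_eq[OF wg_diff[OF FG wg]] .
    show "coulomb_energy \<alpha> p (\<lambda>x. F x - f k x) \<le> ennreal (((1 / 2) ^ k) powr (2 * p))"
    proof (rule coulomb_energy_le_of_AE_tendsto[OF \<alpha> p])
      show "AE x in lebesgue. (\<lambda>j. f j x - f k x) \<longlonglongrightarrow> F x - f k x"
        using F(2) by eventually_elim (intro tendsto_diff tendsto_const)
      show "eventually (\<lambda>j. coulomb_energy \<alpha> p (\<lambda>x. f j x - f k x) \<le> ennreal (((1 / 2) ^ k) powr (2 * p))) sequentially"
        using eventually_ge_at_top[of k] by (rule eventually_mono) (rule E)
    qed measurable
  qed
qed

theorem proposition2p2:
  fixes \<alpha> p :: real
  assumes "0 < \<alpha>" and "\<alpha> < real CARD('n::finite)" and "1 \<le> p"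
  shows "complete_normed_space_on
    (coulomb_sobolev_space \<alpha> p :: 'n ae_fun set) (coulomb_sobolev_norm \<alpha> p)"
proof (rule complete_normed_space_onI)
  let ?S = "coulomb_sobolev_space \<alpha> p :: 'n ae_fun set"
  show N: "normed_space_on ?S (coulomb_sobolev_norm \<alpha> p)"
    by (rule coulomb_sobolev_normed_space[OF assms])
  then have S: "subspace ?S" by (simp add: normed_space_on_def)
  show "0 \<le> coulomb_sobolev_norm \<alpha> p u" for u :: "'n ae_fun"
    by (simp add: coulomb_sobolev_norm_eq)
  show sym: "coulomb_sobolev_norm \<alpha> p (- u) = coulomb_sobolev_norm \<alpha> p u" for u :: "'n ae_fun"
    by (rule coulomb_sobolev_norm_uminus[OF assms(1,2)])
  fix \<sigma> :: "nat \<Rightarrow> 'n ae_fun"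
  assume \<sigma>: "\<And>k. \<sigma> k \<in> ?S"
    and fast: "\<And>j k. k \<le> j \<Longrightarrow> coulomb_sobolev_norm \<alpha> p (\<sigma> j - \<sigma> k) \<le> (1 / 2) ^ k"
  have "\<forall>k. \<exists>f. f \<in> borel_measurable lebesgue \<and> \<sigma> k = abs_ae_fun f"
    using ae_fun_cases by metis
  then obtain f where f: "\<And>k. f k \<in> borel_measurable lebesgue" "\<And>k. \<sigma> k = abs_ae_fun (f k)"
    by metis
  have minus: "abs_ae_fun g - abs_ae_fun h = abs_ae_fun (\<lambda>x. g x - h x)"
    if "g \<in> borel_measurable lebesgue" "h \<in> borel_measurable lebesgue" for g h :: "real^'n \<Rightarrow> real"
    using that by (intro minus_ae_fun.abs_eq ae_rel_refl)
  have wd: "weakly_differentiable (f k)" for k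
    using \<sigma>[of k] f by (simp add: coulomb_sobolev_space_iff ae_energy_abs)
  have diff: "\<sigma> j - \<sigma> k \<in> ?S" for j k by (rule subspace_diff[OF S \<sigma> \<sigma>])
  have D: "dirichlet_energy (\<lambda>x. f j x - f k x) \<le> ennreal (((1 / 2) ^ k)\<^sup>2)"
    and E: "coulomb_energy \<alpha> p (\<lambda>x. f j x - f k x) \<le> ennreal (((1 / 2) ^ k) powr (2 * p))"
    if "k \<le> j" for j k
    using energies_le_of_norm_le[OF diff assms(3) _ fast[OF that]] f
    by (simp_all add: minus ae_energy_abs)
  obtain F where F: "weakly_differentiable F"
    "\<And>k. dirichlet_energy (\<lambda>x. F x - f k x) \<le> ennreal (((1 / 2) ^ k)\<^sup>2)"
    "\<And>k. coulomb_energy \<alpha> p (\<lambda>x. F x - f k x) \<le> ennreal (((1 / 2) ^ k) powr (2 * p))"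
    using fast_Cauchy_energy_limit[OF assms wd D E] by metis
  have mF: "F \<in> borel_measurable lebesgue"
    using F(1) by (auto simp: weakly_differentiable_def has_weak_gradient_def intro: locally_integrable_measurable)
  define u where "u = abs_ae_fun F"
  have Du: "ae_dirichlet_energy (u - \<sigma> k) \<le> ennreal (((1 / 2) ^ k)\<^sup>2)"
    and Eu: "ae_coulomb_energy \<alpha> p (u - \<sigma> k) \<le> ennreal (((1 / 2) ^ k) powr (2 * p))" for k
    using F mF f by (simp_all add: u_def minus ae_energy_abs)
  have "ae_weakly_differentiable u" "ae_weakly_differentiable (\<sigma> k)" for k
    using F(1) mF \<sigma>[of k] by (auto simp: u_def ae_energy_abs coulomb_sobolev_space_iff)
  then have "ae_weakly_differentiable (u - \<sigma> k)" for k
    using subspace_diff[OF subspace_ae_weakly_differentiable, of u "\<sigma> k"] by simp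
  then have "u - \<sigma> k \<in> ?S" for k
    using order_le_less_trans[OF Du[of k]] order_le_less_trans[OF Eu[of k]]
    by (simp add: coulomb_sobolev_space_iff)
  then have "u \<in> ?S"
    using subspace_add[OF S _ \<sigma>[of 0], of "u - \<sigma> 0"] by simp
  moreover have "(\<lambda>k. coulomb_sobolev_norm \<alpha> p (\<sigma> k - u)) \<longlonglongrightarrow> 0"
  proof (rule tendsto_sandwich[OF _ _ tendsto_const])
    have "coulomb_sobolev_norm \<alpha> p (\<sigma> k - u) \<le> 2 * (1 / 2) ^ k" for k
      using norm_le_of_energies_le[OF assms(3) _ Du Eu, of k] sym[of "u - \<sigma> k"] by simp
    then show "eventually (\<lambda>k. coulomb_sobolev_norm \<alpha> p (\<sigma> k - u) \<le> 2 * (1 / 2) ^ k) sequentially"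
      by simp
    have "(\<lambda>k. 2 * (1 / 2) ^ k) \<longlonglongrightarrow> 2 * (0::real)"
      by (intro tendsto_intros LIMSEQ_power_zero) simp
    then show "(\<lambda>k. 2 * (1 / 2) ^ k) \<longlonglongrightarrow> (0::real)" by simp
    show "eventually (\<lambda>k. 0 \<le> coulomb_sobolev_norm \<alpha> p (\<sigma> k - u)) sequentially"
      by (simp add: coulomb_sobolev_norm_eq)
  qed
  ultimately show "\<exists>u\<in>?S. (\<lambda>k. coulomb_sobolev_norm \<alpha> p (\<sigma> k - u)) \<longlonglongrightarrow> 0"
    by blast
qed

end
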